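(* Let $0<\lambda<1$. For the High Memory regime of the RCPB policy with $\mu\ge\lambda/(1-\lambda)$, and for the High Message regime, the asymptotic delay is zero, i.e., $\mathbb{E}[W]=0$.
   Context: Model: for each $n$ there are $n$ unit-rate servers, each with its own infinite-capacity FIFO queue (a job in service counts as in queue); a server is idle iff its queue is empty. Jobs arrive as a Poisson process of rate $\lambda n$, with i.i.d. exponential mean-$1$ sizes independent of arrivals. RCPB policy with parameters $c(n)\in\{1,\dots,n\}$ and $\mu(n)>0$: the dispatcher stores up to $c(n)$ server IDs (tokens); each idle server sends messages as a Poisson process of rate $\mu(n)$, and upon receipt its ID is stored unless it is already stored or memory is full; an arriving job is sent to a server chosen uniformly among stored tokens (that token is deleted), or to a uniformly random queue if there are no tokens. With $Q^n_i(t)$ the number of jobs in queue $i$ and $M^n(t)$ the number of tokens, $(Q^n,M^n)$ is a positive recurrent continuous-time Markov chain on $\{(q,m)\in\mathbb{Z}_+^n\times\{0,\dots,c(n)\}:\sum_i\mathbf{1}_{\{q_i=0\}}\ge m\}$ with rates: $(q,0)\to(q+e_i,0)$ at rate $\lambda$; for $m>0$, $(q,m)\to(q+e_i,m-1)$ at rate $n\lambda\mathbf{1}_{\{q_i=0\}}/\sum_j\mathbf{1}_{\{q_j=0\}}$; $(q,m)\to(q-e_i,m)$ at rate $\mathbf{1}_{\{q_i>0\}}$; $(q,m)\to(q,m+1)$ at rate $\mu(n)(\sum_i\mathbf{1}_{\{q_i=0\}}-m)\mathbf{1}_{\{m<c(n)\}}$. Regimes: High Memory: $c(n)\to\infty$,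 $c(n)/n\to0$, $\mu(n)=\mu>0$ constant. High Message: $c(n)=c\ge1$ constant (only $n\ge c$ considered), $\mu(n)$ nondecreasing with $\mu(n)\to\infty$. $S^n_i$ is the fraction of queues with at least $i$ jobs. The queueing delay $\mathbb{E}[W^n]$ is the steady-state mean time that a job spends in queue until its service starts; by Little's law $\mathbb{E}[W^n]=\frac1\lambda\mathbb{E}\left[\sum_{i=1}^\infty S^n_i\right]-1$ (expectation under the stationary distribution). The asymptotic delay is $\mathbb{E}[W]=\limsup_{n\to\infty}\mathbb{E}[W^n]$. *)

theory Defs
  imports "HOL-Probability.Probability"
begin

section \<open>Continuous-time Markov chains on a countable state space\<close>

definition generator :: "'a set \<Rightarrow> ('a \<Rightarrow> 'a \<Rightarrow> real) \<Rightarrow> 'a \<Rightarrow> 'a \<Rightarrow> real" where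
  "generator S r x y = (if x = y then - (\<Sum>\<^sub>\<infinity>z\<in>S - {x}. r x z) else r x y)"

text \<open>\<open>P t x\<close> is the law at time \<open>t\<close> of the chain started in \<open>x\<close>; only times \<open>t \<ge> 0\<close> and states
  \<open>x \<in> S\<close> matter. For bounded rates (as below, for each fixed number of servers) the semigroup
  is uniquely determined by the rates.\<close>

definition ctmc :: "'a set \<Rightarrow> ('a \<Rightarrow> 'a \<Rightarrow> real) \<Rightarrow> (real \<Rightarrow> 'a \<Rightarrow> 'a pmf) \<Rightarrow> bool" where
  "ctmc S r P \<longleftrightarrow>
     (\<forall>t\<ge>0. \<forall>x\<in>S. set_pmf (P t x) \<subseteq> S) \<and>
     (\<forall>x\<in>S. P 0 x = return_pmf x) \<and>
     (\<forall>s\<ge>0. \<forall>t\<ge>0. \<forall>x\<in>S. P (s + t) x = bind_pmf (P s x) (P t)) \<and>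
     (\<forall>x\<in>S. \<forall>y\<in>S.
        ((\<lambda>t. pmf (P t x) y) has_real_derivative generator S r x y) (at_right 0))"

definition stationary_distribution ::
    "'a set \<Rightarrow> (real \<Rightarrow> 'a \<Rightarrow> 'a pmf) \<Rightarrow> 'a pmf \<Rightarrow> bool" where
  "stationary_distribution S P \<pi> \<longleftrightarrow>
     set_pmf \<pi> \<subseteq> S \<and> (\<forall>t\<ge>0. bind_pmf \<pi> (P t) = \<pi>)"


section \<open>The chain of queue lengths and stored tokens under the RCPB policy\<close>

text \<open>A state is a pair \<open>(q, m)\<close>: \<open>q i\<close> is the number of jobs in queue \<open>i\<close>, for \<open>i < n\<close>, and \<open>m\<close> is
  the number of stored tokens. Vectors in \<open>\<nat>\<^sup>n\<close> are functions vanishing outside \<open>{..<n}\<close>.\<close>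

type_synonym rcpb_state = "(nat \<Rightarrow> nat) \<times> nat"

definition num_idle :: "nat \<Rightarrow> (nat \<Rightarrow> nat) \<Rightarrow> nat" where
  "num_idle n q = card {i. i < n \<and> q i = 0}"

definition rcpb_states :: "nat \<Rightarrow> nat \<Rightarrow> rcpb_state set" where
  "rcpb_states n c = {(q, m). (\<forall>i\<ge>n. q i = 0) \<and> m \<le> c \<and> m \<le> num_idle n q}"

text \<open>The three summands are arrivals to queue \<open>i\<close> (which consume a token if there is one), service
  completions at queue \<open>i\<close>, and messages of idle servers whose token is not yet stored. Targets of
  distinct events are distinct, so at most one term of the sum is nonzero. On
  \<^const>\<open>rcpb_states\<close>, \<open>m > 0\<close> implies that the denominator is positive.\<close>

definition rcpb_rate ::
    "nat \<Rightarrow> real \<Rightarrow> nat \<Rightarrow> real \<Rightarrow> rcpb_state \<Rightarrow> rcpb_state \<Rightarrow> real" where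
  "rcpb_rate n lam c \<mu> = (\<lambda>(q, m) y.
     (\<Sum>i<n. (if m = 0 then lam
               else real n * lam * of_bool (q i = 0) / real (num_idle n q))
             * of_bool (y = (q(i := q i + 1), m - 1))) +
     (\<Sum>i<n. of_bool (q i > 0) * of_bool (y = (q(i := q i - 1), m))) +
     \<mu> * (real (num_idle n q) - real m) * of_bool (m < c) * of_bool (y = (q, m + 1)))"


section \<open>Regimes\<close>

definition high_memory :: "(nat \<Rightarrow> nat) \<Rightarrow> (nat \<Rightarrow> real) \<Rightarrow> real \<Rightarrow> bool" where
  "high_memory c \<mu> \<mu>0 \<longleftrightarrow>
     (\<forall>n\<ge>1. c n \<in> {1..n}) \<and> filterlim c at_top sequentially \<and>
     (\<lambda>n. real (c n) / real n) \<longlonglongrightarrow> 0 \<and>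
     \<mu>0 > 0 \<and> (\<forall>n\<ge>1. \<mu> n = \<mu>0)"

definition high_message :: "(nat \<Rightarrow> nat) \<Rightarrow> (nat \<Rightarrow> real) \<Rightarrow> bool" where
  "high_message c \<mu> \<longleftrightarrow>
     (\<exists>c0\<ge>1. (\<forall>n. c n = c0) \<and> (\<forall>n\<ge>c0. \<mu> n > 0) \<and>
        mono_on {c0..} \<mu> \<and> filterlim \<mu> at_top sequentially)"


section \<open>Queueing delay\<close>

definition queue_fraction :: "nat \<Rightarrow> nat \<Rightarrow> (nat \<Rightarrow> nat) \<Rightarrow> real" where
  "queue_fraction n i q = real (card {j. j < n \<and> q j \<ge> i}) / real n"

text \<open>Steady-state mean time in queue before service, for unit-mean services, expressed through the
  stationary distribution by Little's law. It is extended-real-valued, so that an infinite mean queue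
  length yields an infinite delay.\<close>

definition queueing_delay :: "nat \<Rightarrow> real \<Rightarrow> rcpb_state pmf \<Rightarrow> ereal" where
  "queueing_delay n lam \<pi> =
     ereal (1 / lam) *
       enn2ereal (\<integral>\<^sup>+(q, m). (\<Sum>i. ennreal (queue_fraction n (Suc i) q)) \<partial>measure_pmf \<pi>) - 1"

definition asymptotic_delay :: "real \<Rightarrow> (nat \<Rightarrow> rcpb_state pmf) \<Rightarrow> ereal" where
  "asymptotic_delay lam \<pi> = limsup (\<lambda>n. queueing_delay n lam (\<pi> n))"

end

theory Submission
  imports Defs
begin

text \<open>
  The delay is the mean queue length per server, divided by \<open>\<lambda>\<close>, minus \<open>1\<close>. Jobs reach an empty queue
  whenever a token is stored, so a positive delay can only come from the times without tokens. The
  proof makes this quantitative with a few drift identities for each fixed \<open>n\<close>.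

  The basic tool is that the stationary distribution annihilates the generator on bounded functions
  (\<open>expect_drift\<close>). Write \<open>I\<close> for the number of idle servers and \<open>p = P(m = 0)\<close> for the stationary
  probability that no token is stored.

  \<^item> \<^emph>\<open>It suffices that \<open>p \<rightarrow> 0\<close>.\<close> The drift of a quadratic function of the queue lengths gives
    \<open>E X \<le> \<lambda>n + \<lambda> E [X; m = 0]\<close> for the total number of jobs \<open>X\<close>, and that of a cubic one gives
    \<open>E \<Sum>\<^sub>i q\<^sub>i\<^sup>2 = O(n)\<close>. Together they bound the delay by a constant times
    \<open>\<surd>(p + 1/n)\<close> (\<open>queueing_delay_le_sqrt\<close>). The delay is nonnegative because \<open>E I = n (1 - \<lambda>)\<close>.

  \<^item> \<^emph>\<open>The idle fraction concentrates.\<close> Put \<open>w = max 0 (I/n - (1 - \<lambda>))\<close>. The drift of a discrete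
    antiderivative of \<open>w\<close> in the variable \<open>I\<close> yields \<open>E w\<^sup>2 \<le> \<lambda> E [w; m = 0] + 1/n\<close>: while tokens are
    stored, every arrival fills an idle server, which pushes \<open>I/n\<close> down to \<open>1 - \<lambda>\<close>
    (\<open>expect_excess_square_le\<close>). As \<open>I/n\<close> has mean \<open>1 - \<lambda>\<close>, a small \<open>E w\<close> also controls its deficit.

  \<^item> \<^emph>\<open>Tokens are seldom missing.\<close> Balancing the flow between the token levels \<open>k\<close> and \<open>k + 1\<close>, with a
    weight depending on \<open>I\<close>, compares the creation rate \<open>\<mu> (I - k)\<close> with the consumption rate \<open>\<lambda>n\<close>
    (\<open>token_level_cut\<close>). When \<open>\<mu> (1 - \<lambda>) \<ge> \<lambda>\<close> and \<open>I/n\<close> is about \<open>1 - \<lambda>\<close> or larger, level \<open>k + 1\<close> is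
    hardly less likely than level \<open>k\<close>, so level \<open>0\<close> has probability at most about \<open>1/K\<close> for every
    fixed \<open>K\<close>, once \<open>K \<le> c(n)\<close> (\<open>no_tokens_le_by_cuts\<close>). When \<open>\<mu>\<close> is large, the first cut alone bounds
    \<open>E [I/n; m = 0]\<close> by \<open>2 \<lambda>/\<mu>\<close>.

  In both regimes the cuts are used twice. First they give \<open>E [w; m = 0] \<rightarrow> 0\<close> with no prior knowledge of
  the distribution of \<open>I\<close>: either through the weight \<open>w\<close>, which only sees states where \<open>I/n\<close> exceeds its
  mean, or, for large \<open>\<mu>\<close>, because \<open>w \<le> I/n\<close>. Hence \<open>E w \<rightarrow> 0\<close>. Then, with weight \<open>1\<close> and with the
  concentration just obtained, they give \<open>p \<rightarrow> 0\<close>.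
\<close>

section \<open>Stationary distributions annihilate the generator\<close>

text \<open>Used to compare \<open>E\<^sub>x f(X\<^sub>t)\<close> with the finitely many jumps that are possible at first order in \<open>t\<close>;
  the error is the mass that the law puts elsewhere.\<close>

lemma expectation_approx_on_finite_set:
  fixes D :: "'a pmf" and g :: "'a \<Rightarrow> real"
  assumes "finite A" and g: "\<And>z. \<bar>g z\<bar> \<le> B"
  shows "\<bar>measure_pmf.expectation D g - (\<Sum>z\<in>A. pmf D z * g z)\<bar> \<le> B * (1 - (\<Sum>z\<in>A. pmf D z))"
proof -
  have B: "0 \<le> B" using g[of undefined] by linarith
  have int: "integrable (measure_pmf D) g"
    by (rule measure_pmf.integrable_const_bound[where B=B]) (use g in auto)
  have intA: "integrable (measure_pmf D) (\<lambda>z. indicator A z * g z)" for A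
    by (rule measure_pmf.integrable_const_bound[where B=B])
      (use g B in \<open>auto simp: indicator_def abs_mult\<close>)
  have "(\<Sum>z\<in>A. pmf D z * g z) = measure_pmf.expectation D (\<lambda>z. indicator A z * g z)"
    by (subst integral_measure_pmf_real[OF \<open>finite A\<close>])
      (auto simp: indicator_def mult.commute intro!: sum.cong split: if_splits)
  then have "measure_pmf.expectation D g - (\<Sum>z\<in>A. pmf D z * g z)
      = measure_pmf.expectation D (\<lambda>z. g z - indicator A z * g z)"
    using int intA by simp
  also have "\<dots> = measure_pmf.expectation D (\<lambda>z. indicator (- A) z * g z)"
    by (rule Bochner_Integration.integral_cong) (auto simp: indicator_def)
  finally have "\<bar>measure_pmf.expectation D g - (\<Sum>z\<in>A. pmf D z * g z)\<bar>
      \<le> measure_pmf.expectation D (\<lambda>z. \<bar>indicator (- A) z * g z\<bar>)"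
    by (simp only: integral_abs_bound)
  also have "\<dots> \<le> measure_pmf.expectation D (\<lambda>z. B * indicator (- A) z)"
  proof (rule integral_mono)
    show "integrable D (\<lambda>z. \<bar>indicator (- A) z * g z\<bar>)"
      using intA by (rule integrable_abs)
    show "integrable D (\<lambda>z. B * indicator (- A) z)"
      by (rule measure_pmf.integrable_const_bound[where B=B]) (use B in \<open>auto simp: indicator_def\<close>)
  qed (use g in \<open>auto simp: indicator_def\<close>)
  also have "\<dots> = B * (1 - measure_pmf.prob D A)"
    by (simp add: measure_pmf.prob_compl[symmetric] Compl_eq_Diff_UNIV)
  finally show ?thesis
    using \<open>finite A\<close> by (simp add: measure_measure_pmf_finite)
qed

lemma expectation_bind_pmf:
  fixes f :: "'b \<Rightarrow> real"
  assumes "\<And>z. \<bar>f z\<bar> \<le> B"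
  shows "measure_pmf.expectation (bind_pmf D K) f
    = measure_pmf.expectation D (\<lambda>x. measure_pmf.expectation (K x) f)"
  unfolding measure_pmf_bind
  by (rule integral_bind[where K="count_space UNIV" and B=B and B'=1])
    (use assms in \<open>auto simp: measure_pmf_in_subprob_algebra measure_pmf.finite_measure\<close>)

text \<open>Subadditivity gives \<open>u t / t \<le> u (t/k) / (t/k)\<close> for all \<open>k \<ge> 1\<close>, and the right-hand side tends to
  the derivative at \<open>0\<close>.\<close>

lemma subadditive_le_right_derivative:
  fixes u :: "real \<Rightarrow> real"
  assumes sub: "\<And>s t. 0 \<le> s \<Longrightarrow> 0 \<le> t \<Longrightarrow> u (s + t) \<le> u s + u t"
    and u0: "u 0 = 0" and der: "(u has_real_derivative d) (at_right 0)" and t: "0 \<le> t"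
  shows "u t \<le> d * t"
proof (cases "t = 0")
  case False
  with t have t: "0 < t" by simp
  have split: "u (real k * s) \<le> real k * u s" if "0 \<le> s" for k s
  proof (induction k)
    case (Suc k)
    have "u (real (Suc k) * s) = u (real k * s + s)" by (simp add: algebra_simps)
    also have "\<dots> \<le> u (real k * s) + u s" using that by (intro sub) auto
    finally show ?case using Suc by (simp add: algebra_simps)
  qed (simp add: u0)
  have "((\<lambda>s. u s / s) \<longlongrightarrow> d) (at_right 0)"
    using der u0 by (simp add: has_field_derivative_iff)
  moreover have "filterlim (\<lambda>k. t / real (Suc k)) (at_right 0) sequentially"
    using t by (intro tendsto_imp_filterlim_at_right LIMSEQ_Suc[OF lim_const_over_n]) auto
  ultimately have "(\<lambda>k. u (t / real (Suc k)) / (t / real (Suc k))) \<longlonglongrightarrow> d"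
    by (rule filterlim_compose)
  moreover have "u t / t \<le> u (t / real (Suc k)) / (t / real (Suc k))" for k
  proof -
    have "real (Suc k) * (t / real (Suc k)) = t" by simp
    then have "u t \<le> real (Suc k) * u (t / real (Suc k))"
      using split[of "t / real (Suc k)" "Suc k"] t by simp
    then have "u t / t \<le> real (Suc k) * u (t / real (Suc k)) / t"
      using t by (intro divide_right_mono) auto
    then show ?thesis by (simp add: mult.commute)
  qed
  ultimately have "u t / t \<le> d"
    by (intro LIMSEQ_le_const) auto
  then show ?thesis using t by (simp add: field_simps)
qed (simp add: u0)

text \<open>A derivative at \<open>0\<close> alone gives no bound that is uniform in the starting state. Here it does: staying
  put for time \<open>s\<close> and again for time \<open>t\<close> is one way to be back at time \<open>s + t\<close>, so the exit
  probability is subadditive in time.\<close>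

lemma ctmc_exit_probability_le:
  assumes P: "ctmc S r P" and x: "x \<in> S" and t: "0 \<le> t"
  shows "1 - pmf (P t x) x \<le> - generator S r x x * t"
proof (rule subadditive_le_right_derivative[OF _ _ _ t])
  show "1 - pmf (P 0 x) x = 0" using P x by (simp add: ctmc_def)
  show "((\<lambda>t. 1 - pmf (P t x) x) has_real_derivative - generator S r x x) (at_right 0)"
    using P x unfolding ctmc_def by (auto intro!: derivative_eq_intros)
  fix s t :: real assume st: "0 \<le> s" "0 \<le> t"
  have "pmf (P s x) x * pmf (P t x) x
      = measure_pmf.expectation (P s x) (\<lambda>y. indicator {x} y * pmf (P t x) x)"
    by (simp add: pmf.rep_eq)
  also have "\<dots> \<le> measure_pmf.expectation (P s x) (\<lambda>y. pmf (P t y) x)"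
    by (rule integral_mono)
      (auto simp: indicator_def pmf_le_1 intro!: measure_pmf.integrable_const_bound[where B=1])
  also have "\<dots> = pmf (P (s + t) x) x"
    using P x st by (simp add: ctmc_def pmf_bind)
  finally have "pmf (P s x) x * pmf (P t x) x \<le> pmf (P (s + t) x) x" .
  moreover have "0 \<le> (1 - pmf (P s x) x) * (1 - pmf (P t x) x)"
    by (simp add: pmf_le_1)
  ultimately show "1 - pmf (P (s + t) x) x \<le> (1 - pmf (P s x) x) + (1 - pmf (P t x) x)"
    by (simp add: algebra_simps)
qed

text \<open>Stationarity says that \<open>E\<^sub>x f(X\<^sub>t) - f x\<close> has mean \<open>0\<close> for every \<open>t\<close>. Divided by \<open>t\<close> it tends to the
  generator applied to \<open>f\<close>, and by the previous bound it is dominated by a constant when the exit rates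
  are bounded, so that the limit may be taken under the expectation. The set \<open>T x\<close> contains all states
  reachable from \<open>x\<close> in one jump; it may contain points outside the state space, whose rate is \<open>0\<close>.\<close>

lemma stationary_generator_expectation_0:
  fixes f :: "'a \<Rightarrow> real"
  assumes P: "ctmc S r P" and \<pi>: "stationary_distribution S P \<pi>"
    and fin: "\<And>x. x \<in> S \<Longrightarrow> finite (T x)" and self: "\<And>x. x \<in> S \<Longrightarrow> x \<notin> T x"
    and out: "\<And>x z. x \<in> S \<Longrightarrow> z \<in> T x - S \<Longrightarrow> r x z = 0"
    and supp: "\<And>x z. x \<in> S \<Longrightarrow> z \<in> S - {x} - T x \<Longrightarrow> r x z = 0"
    and C: "\<And>x. x \<in> S \<Longrightarrow> (\<Sum>z\<in>T x. r x z) \<le> C"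
    and f: "\<And>x. \<bar>f x\<bar> \<le> M"
  shows "measure_pmf.expectation \<pi> (\<lambda>x. \<Sum>z\<in>T x. r x z * (f z - f x)) = 0"
proof -
  have \<pi>S: "set_pmf \<pi> \<subseteq> S" using \<pi> by (simp add: stationary_distribution_def)
  have M: "0 \<le> M" using f[of undefined] by linarith
  define step where "step k = 1 / real (Suc k)" for k :: nat
  have step_pos: "0 < step k" for k by (simp add: step_def)
  have step_lim: "filterlim step (at_right 0) sequentially"
    unfolding step_def by (intro tendsto_imp_filterlim_at_right LIMSEQ_Suc[OF lim_const_over_n]) auto
  define h where "h k x = (measure_pmf.expectation (P (step k) x) f - f x) / step k" for k x

  have diff: "measure_pmf.expectation (P t x) (\<lambda>z. f z - f x) = measure_pmf.expectation (P t x) f - f x" for t x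
    by (subst Bochner_Integration.integral_diff)
      (auto intro!: measure_pmf.integrable_const_bound[where B=M] f)
  have fdiff: "\<bar>f z - f x\<bar> \<le> 2 * M" for z x
    using f[of z] f[of x] by linarith
  have gen_self: "generator S r x x = - (\<Sum>z\<in>T x \<inter> S. r x z)" if x: "x \<in> S" for x
  proof -
    have "(\<Sum>\<^sub>\<infinity>z\<in>S - {x}. r x z) = (\<Sum>\<^sub>\<infinity>z\<in>T x \<inter> S. r x z)"
      by (rule infsum_cong_neutral) (use x supp self in auto)
    then show ?thesis using fin[OF x] by (simp add: generator_def)
  qed
  have sumT: "(\<Sum>z\<in>T x \<inter> S. r x z * a z) = (\<Sum>z\<in>T x. r x z * a z)" if x: "x \<in> S" for x a
    by (rule sum.mono_neutral_left) (use x fin out in auto)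

  have bound: "\<bar>h k x\<bar> \<le> 2 * M * C" if x: "x \<in> S" for k x
  proof -
    have "\<bar>measure_pmf.expectation (P (step k) x) f - f x\<bar> \<le> 2 * M * (1 - pmf (P (step k) x) x)"
      using expectation_approx_on_finite_set[of "{x}" "\<lambda>z. f z - f x" "2 * M" "P (step k) x"]
      by (simp add: fdiff diff)
    also have "\<dots> \<le> 2 * M * (C * step k)"
    proof (rule mult_left_mono)
      have "1 - pmf (P (step k) x) x \<le> - generator S r x x * step k"
        using step_pos[of k] by (intro ctmc_exit_probability_le[OF P x]) simp
      also have "\<dots> \<le> C * step k"
        using C[OF x] sumT[OF x, of "\<lambda>_. 1"] step_pos[of k] by (simp add: gen_self[OF x])
      finally show "1 - pmf (P (step k) x) x \<le> C * step k" .
    qed (use M in simp)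
    finally show ?thesis
      unfolding h_def using step_pos[of k] by (simp add: field_simps)
  qed

  have lim: "(\<lambda>k. h k x) \<longlonglongrightarrow> (\<Sum>z\<in>T x. r x z * (f z - f x))" if x: "x \<in> S" for x
  proof -
    let ?A = "T x \<inter> S"
    have A: "finite ?A" "x \<notin> ?A" using fin[OF x] self[OF x] by auto
    have der: "(\<lambda>k. (pmf (P (step k) x) z - pmf (P 0 x) z) / step k) \<longlonglongrightarrow> generator S r x z"
      if z: "z \<in> S" for z
    proof -
      have "((\<lambda>t. pmf (P t x) z) has_real_derivative generator S r x z) (at_right 0)"
        using P x z by (simp add: ctmc_def)
      then have "((\<lambda>t. (pmf (P t x) z - pmf (P 0 x) z) / (t - 0)) \<longlongrightarrow> generator S r x z) (at_right 0)"
        by (simp only: has_field_derivative_iff)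
      from filterlim_compose[OF this step_lim] show ?thesis by simp
    qed
    have P0: "P 0 x = return_pmf x" using P x by (simp add: ctmc_def)
    have jump: "(\<lambda>k. pmf (P (step k) x) z / step k) \<longlonglongrightarrow> r x z" if "z \<in> ?A" for z
    proof -
      have "z \<noteq> x" "z \<in> S" using that A by auto
      then show ?thesis using der[of z] by (simp add: P0 generator_def)
    qed
    have stay: "(\<lambda>k. (1 - pmf (P (step k) x) x) / step k) \<longlonglongrightarrow> (\<Sum>z\<in>?A. r x z)"
      using tendsto_minus[OF der[OF x]] by (simp add: P0 gen_self[OF x] minus_divide_left)
    have main: "(\<lambda>k. \<Sum>z\<in>?A. pmf (P (step k) x) z / step k * (f z - f x))
        \<longlonglongrightarrow> (\<Sum>z\<in>?A. r x z * (f z - f x))"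
      by (intro tendsto_sum tendsto_mult jump tendsto_const)
    have "(\<lambda>k. (1 - pmf (P (step k) x) x) / step k - (\<Sum>z\<in>?A. pmf (P (step k) x) z / step k))
        \<longlonglongrightarrow> (\<Sum>z\<in>?A. r x z) - (\<Sum>z\<in>?A. r x z)"
      by (intro tendsto_diff stay tendsto_sum jump)
    \<comment> \<open>Mass that is neither at the starting state nor at a possible target vanishes faster than the step.\<close>
    then have err: "(\<lambda>k. 2 * M * ((1 - pmf (P (step k) x) x) / step k - (\<Sum>z\<in>?A. pmf (P (step k) x) z / step k)))
        \<longlonglongrightarrow> 0"
      by (intro tendsto_mult_right_zero) simp
    have "\<bar>h k x - (\<Sum>z\<in>?A. pmf (P (step k) x) z / step k * (f z - f x))\<bar>
        \<le> 2 * M * ((1 - pmf (P (step k) x) x) / step k - (\<Sum>z\<in>?A. pmf (P (step k) x) z / step k))" for k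
    proof -
      let ?p = "pmf (P (step k) x)" and ?s = "step k"
      have "h k x - (\<Sum>z\<in>?A. ?p z / ?s * (f z - f x))
          = (measure_pmf.expectation (P ?s x) f - f x - (\<Sum>z\<in>?A. ?p z * (f z - f x))) / ?s"
        by (simp add: h_def diff_divide_distrib sum_divide_distrib)
      also have "\<bar>\<dots>\<bar> \<le> (2 * M * (1 - ?p x - sum ?p ?A)) / ?s"
        using expectation_approx_on_finite_set[of "insert x ?A" "\<lambda>z. f z - f x" "2 * M" "P ?s x"]
          A step_pos[of k]
        by (simp add: fdiff diff divide_right_mono diff_diff_eq)
      also have "\<dots> = 2 * M * ((1 - ?p x) / ?s - (\<Sum>z\<in>?A. ?p z / ?s))"
        by (simp add: diff_divide_distrib right_diff_distrib flip: sum_divide_distrib)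
      finally show ?thesis .
    qed
    then have "(\<lambda>k. h k x - (\<Sum>z\<in>?A. pmf (P (step k) x) z / step k * (f z - f x))) \<longlonglongrightarrow> 0"
      by (intro Lim_null_comparison[OF _ err]) simp
    from tendsto_add[OF this main] show ?thesis
      by (simp add: sumT[OF x])
  qed

  have "measure_pmf.expectation \<pi> (h k) = 0" for k
  proof -
    have "measure_pmf.expectation \<pi> (\<lambda>x. measure_pmf.expectation (P (step k) x) f)
        = measure_pmf.expectation (bind_pmf \<pi> (P (step k))) f"
      by (rule expectation_bind_pmf[OF f, symmetric])
    also have "\<dots> = measure_pmf.expectation \<pi> f"
      using \<pi> step_pos[of k] by (simp add: stationary_distribution_def)
    finally have eq: "measure_pmf.expectation \<pi> (\<lambda>x. measure_pmf.expectation (P (step k) x) f)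
        = measure_pmf.expectation \<pi> f" .
    have "integrable \<pi> (\<lambda>x. measure_pmf.expectation (P (step k) x) f)"
    proof (rule measure_pmf.integrable_const_bound[where B=M])
      show "AE x in measure_pmf \<pi>. norm (measure_pmf.expectation (P (step k) x) f) \<le> M"
        using expectation_approx_on_finite_set[of "{}" f M] f by simp
    qed simp
    moreover have "integrable \<pi> f"
      by (rule measure_pmf.integrable_const_bound[where B=M]) (use f in auto)
    ultimately show ?thesis unfolding h_def using eq by simp
  qed
  moreover have "(\<lambda>k. measure_pmf.expectation \<pi> (h k))
      \<longlonglongrightarrow> measure_pmf.expectation \<pi> (\<lambda>x. \<Sum>z\<in>T x. r x z * (f z - f x))"
  proof (rule integral_dominated_convergence[where w="\<lambda>_. 2 * M * C"])
    show "AE x in measure_pmf \<pi>. (\<lambda>k. h k x) \<longlonglongrightarrow> (\<Sum>z\<in>T x. r x z * (f z - f x))"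
      using lim \<pi>S by (auto simp: AE_measure_pmf_iff)
    show "AE x in measure_pmf \<pi>. norm (h k x) \<le> 2 * M * C" for k
      using bound \<pi>S by (auto simp: AE_measure_pmf_iff)
  qed auto
  ultimately show ?thesis
    by (simp add: LIMSEQ_const_iff)
qed

section \<open>The drift of the chain\<close>

text \<open>The generator of the chain applied to \<open>f\<close>, as a sum over events instead of target states.\<close>

definition rcpb_drift ::
    "nat \<Rightarrow> real \<Rightarrow> nat \<Rightarrow> real \<Rightarrow> (rcpb_state \<Rightarrow> real) \<Rightarrow> rcpb_state \<Rightarrow> real" where
  "rcpb_drift n lam c \<mu> f = (\<lambda>(q, m).
     (\<Sum>i<n. (if m = 0 then lam
               else real n * lam * of_bool (q i = 0) / real (num_idle n q))
             * (f (q(i := q i + 1), m - 1) - f (q, m))) +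
     (\<Sum>i<n. of_bool (q i > 0) * (f (q(i := q i - 1), m) - f (q, m))) +
     \<mu> * (real (num_idle n q) - real m) * of_bool (m < c) * (f (q, m + 1) - f (q, m)))"

definition rcpb_targets :: "nat \<Rightarrow> rcpb_state \<Rightarrow> rcpb_state set" where
  "rcpb_targets n = (\<lambda>(q, m).
     (\<lambda>i. (q(i := q i + 1), m - 1)) ` {..<n} \<union> (\<lambda>i. (q(i := q i - 1), m)) ` {i. i < n \<and> q i > 0}
     \<union> {(q, m + 1)})"

lemma num_idle_le: "num_idle n q \<le> n"
  unfolding num_idle_def using card_mono[of "{..<n}" "{i. i < n \<and> q i = 0}"] by auto

lemma num_idle_eq_sum: "real (num_idle n q) = (\<Sum>i<n. of_bool (q i = 0))"
  by (simp add: num_idle_def of_bool_def sum.If_cases Int_def flip: lessThan_def)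

lemma num_idle_update:
  assumes "i < n"
  shows "real (num_idle n (q(i := v))) = real (num_idle n q) - of_bool (q i = 0) + of_bool (v = 0)"
proof -
  have split: "real (num_idle n p) = of_bool (p i = 0) + (\<Sum>j\<in>{..<n} - {i}. of_bool (p j = 0))" for p
    unfolding num_idle_eq_sum using assms by (intro sum.remove) auto
  have "(\<Sum>j\<in>{..<n} - {i}. of_bool ((q(i := v)) j = 0)) = (\<Sum>j\<in>{..<n} - {i}. of_bool (q j = 0) :: real)"
    by (rule sum.cong) auto
  with split[of q] split[of "q(i := v)"] show ?thesis
    unfolding fun_upd_same by linarith
qed

text \<open>Turns the sum over target states in the generator into a sum over events. Coinciding
  targets do no harm, because the rate is itself a sum over events.\<close>

lemma sum_rcpb_rate_targets:
  "(\<Sum>z\<in>rcpb_targets n (q, m). rcpb_rate n lam c \<mu> (q, m) z * g z) =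
     (\<Sum>i<n. (if m = 0 then lam
               else real n * lam * of_bool (q i = 0) / real (num_idle n q)) * g (q(i := q i + 1), m - 1)) +
     (\<Sum>i<n. of_bool (q i > 0) * g (q(i := q i - 1), m)) +
     \<mu> * (real (num_idle n q) - real m) * of_bool (m < c) * g (q, m + 1)"
proof -
  let ?T = "rcpb_targets n (q, m)"
  have fin: "finite ?T" by (simp add: rcpb_targets_def)
  have pick: "(\<Sum>z\<in>?T. a * of_bool (z = t) * g z) = a * g t" if "a \<noteq> 0 \<Longrightarrow> t \<in> ?T" for a t
  proof (cases "a = 0")
    case False
    then have "(\<Sum>z\<in>?T. a * of_bool (z = t) * g z) = (\<Sum>z\<in>{t}. a * of_bool (z = t) * g z)"
      using that fin by (intro sum.mono_neutral_right) auto
    then show ?thesis by simp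
  qed simp
  have "(\<Sum>z\<in>?T. (\<Sum>i<n. a i * of_bool (z = t i)) * g z) = (\<Sum>i<n. a i * g (t i))"
    if "\<And>i. i < n \<Longrightarrow> a i \<noteq> 0 \<Longrightarrow> t i \<in> ?T" for a t
  proof -
    have "(\<Sum>z\<in>?T. (\<Sum>i<n. a i * of_bool (z = t i)) * g z)
        = (\<Sum>i<n. \<Sum>z\<in>?T. a i * of_bool (z = t i) * g z)"
      unfolding sum_distrib_right by (rule sum.swap)
    also have "\<dots> = (\<Sum>i<n. a i * g (t i))"
      by (intro sum.cong refl pick) (use that in auto)
    finally show ?thesis .
  qed
  note picks = this
  show ?thesis
    unfolding rcpb_rate_def prod.case distrib_right sum.distrib
    by (subst picks, simp add: rcpb_targets_def, subst picks, force simp: rcpb_targets_def split: if_splits,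
        subst pick) (auto simp: rcpb_targets_def)
qed

lemma rcpb_rate_nonzero:
  assumes x: "(q, m) \<in> rcpb_states n c" and r: "rcpb_rate n lam c \<mu> (q, m) z \<noteq> 0"
  shows "z \<in> rcpb_targets n (q, m) \<inter> rcpb_states n c"
proof -
  let ?S = "rcpb_states n c" and ?T = "rcpb_targets n (q, m)"
  have m: "m \<le> c" "m \<le> num_idle n q" and q: "\<And>i. i \<ge> n \<Longrightarrow> q i = 0"
    using x by (auto simp: rcpb_states_def)
  consider
      (arrival) i where "i < n" "m = 0 \<or> q i = 0" "z = (q(i := q i + 1), m - 1)"
    | (departure) i where "i < n" "q i > 0" "z = (q(i := q i - 1), m)"
    | (token) "real (num_idle n q) - real m \<noteq> 0" "m < c" "z = (q, m + 1)"
    using r unfolding rcpb_rate_def prod.case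
    by (smt (verit, ccfv_threshold) lessThan_iff mult_eq_0_iff of_bool_eq_0_iff divide_eq_0_iff sum.neutral)
  then show ?thesis
  proof cases
    case arrival
    have "m - 1 \<le> num_idle n (q(i := q i + 1))"
    proof (cases "m = 0")
      case False
      then have "real m \<le> real (num_idle n (q(i := q i + 1))) + 1"
        using m arrival num_idle_update[OF arrival(1), of q "q i + 1"] by simp
      then show ?thesis by linarith
    qed simp
    then show ?thesis
      using arrival m q by (auto simp: rcpb_states_def rcpb_targets_def)
  next
    case departure
    have "real m \<le> real (num_idle n (q(i := q i - 1)))"
      using m departure num_idle_update[OF departure(1), of q "q i - 1"] by simp
    then show ?thesis
      using departure m q by (auto simp: rcpb_states_def rcpb_targets_def)
  next
    case token
    then show ?thesis
      using m q by (auto simp: rcpb_states_def rcpb_targets_def)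
  qed
qed

lemma rcpb_targets_irrefl: "x \<notin> rcpb_targets n x"
proof
  obtain q m where x: "x = (q, m)" by fastforce
  assume "x \<in> rcpb_targets n x"
  then obtain i where "q(i := q i + 1) = q \<or> (q(i := q i - 1) = q \<and> q i > 0)"
    unfolding x rcpb_targets_def by auto metis+
  then have "(q(i := q i + 1)) i = q i \<or> (q(i := q i - 1)) i = q i \<and> q i > 0" by metis
  then show False by auto
qed

lemma sum_arrival_rates:
  assumes "(q, m) \<in> rcpb_states n c" "m > 0"
  shows "(\<Sum>i<n. real n * lam * of_bool (q i = 0) / real (num_idle n q)) = real n * lam"
proof -
  have "num_idle n q > 0" using assms by (auto simp: rcpb_states_def)
  moreover have "(\<Sum>i<n. real n * lam * of_bool (q i = 0) / real (num_idle n q))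
      = real n * lam * real (num_idle n q) / real (num_idle n q)"
    by (simp only: num_idle_eq_sum sum_distrib_left sum_divide_distrib)
  ultimately show ?thesis by simp
qed

text \<open>All estimates up to the final limit concern one fixed number of servers.\<close>

locale stationary_rcpb =
  fixes n c :: nat and lam \<mu> :: real
    and P :: "real \<Rightarrow> rcpb_state \<Rightarrow> rcpb_state pmf" and \<pi> :: "rcpb_state pmf"
  assumes lam: "0 < lam" "lam < 1" and c: "c \<in> {1..n}" and mu: "0 < \<mu>"
    and chain: "ctmc (rcpb_states n c) (rcpb_rate n lam c \<mu>) P"
    and stationary: "stationary_distribution (rcpb_states n c) P \<pi>"
begin

abbreviation "S \<equiv> rcpb_states n c"
abbreviation "drift \<equiv> rcpb_drift n lam c \<mu>"
abbreviation "expect \<equiv> measure_pmf.expectation \<pi>"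
abbreviation idle :: "rcpb_state \<Rightarrow> real" where "idle x \<equiv> real (num_idle n (fst x))"
abbreviation tokens :: "rcpb_state \<Rightarrow> nat" where "tokens x \<equiv> snd x"

lemma n_pos: "n \<ge> 1" using c by auto

lemma AE_states: "AE x in measure_pmf \<pi>. x \<in> S"
  using stationary by (auto simp: stationary_distribution_def AE_measure_pmf_iff)

lemma integrable_bounded:
  fixes u :: "rcpb_state \<Rightarrow> real"
  assumes "\<And>x. x \<in> S \<Longrightarrow> \<bar>u x\<bar> \<le> B"
  shows "integrable \<pi> u"
  by (rule measure_pmf.integrable_const_bound[where B=B]) (use AE_states assms in auto)

lemma expect_mono:
  fixes u v :: "rcpb_state \<Rightarrow> real"
  assumes "integrable \<pi> u" "integrable \<pi> v" "\<And>x. x \<in> S \<Longrightarrow> u x \<le> v x"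
  shows "expect u \<le> expect v"
  by (rule integral_mono_AE) (use assms AE_states in auto)

definition exit_bound :: real where "exit_bound = real n * lam + real n + \<mu> * real n"

lemma rcpb_rate_nonneg: "x \<in> S \<Longrightarrow> 0 \<le> rcpb_rate n lam c \<mu> x z"
  using lam mu unfolding rcpb_rate_def rcpb_states_def
  by (auto intro!: add_nonneg_nonneg sum_nonneg mult_nonneg_nonneg)

lemma exit_rate_le:
  assumes "x \<in> S"
  shows "(\<Sum>z\<in>rcpb_targets n x. rcpb_rate n lam c \<mu> x z) \<le> exit_bound"
proof -
  obtain q m where x: "x = (q, m)" by fastforce
  have "(\<Sum>i<n. if m = 0 then lam else real n * lam * of_bool (q i = 0) / real (num_idle n q)) = real n * lam"
    using sum_arrival_rates assms by (cases "m = 0") (auto simp: x)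
  moreover have "(\<Sum>i<n. of_bool (q i > 0) :: real) \<le> (\<Sum>i<n. 1)"
    by (intro sum_mono) auto
  moreover have "\<mu> * (real (num_idle n q) - real m) * of_bool (m < c) \<le> \<mu> * real n"
  proof -
    have "real (num_idle n q) - real m \<le> real n" using num_idle_le[of n q] by linarith
    then have "\<mu> * (real (num_idle n q) - real m) \<le> \<mu> * real n" using mu by simp
    then show ?thesis using mu by (auto simp: of_bool_def)
  qed
  ultimately show ?thesis
    using sum_rcpb_rate_targets[where g="\<lambda>_. 1"] by (simp add: x exit_bound_def)
qed

lemma drift_eq:
  "drift f x = (\<Sum>z\<in>rcpb_targets n x. rcpb_rate n lam c \<mu> x z * (f z - f x))"
  by (cases x) (simp only: sum_rcpb_rate_targets rcpb_drift_def prod.case)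

lemma expect_drift:
  assumes "\<And>x. \<bar>f x\<bar> \<le> M"
  shows "expect (drift f) = 0"
proof -
  have "expect (\<lambda>x. \<Sum>z\<in>rcpb_targets n x. rcpb_rate n lam c \<mu> x z * (f z - f x)) = 0"
  proof (rule stationary_generator_expectation_0[OF chain stationary _ _ _ _ exit_rate_le assms])
    show "finite (rcpb_targets n x)" for x by (cases x) (simp add: rcpb_targets_def)
  qed (use rcpb_rate_nonzero rcpb_targets_irrefl in fastforce)+
  then show ?thesis by (simp add: drift_eq[abs_def])
qed

lemma integrable_drift:
  assumes f: "\<And>x. \<bar>f x\<bar> \<le> M"
  shows "integrable \<pi> (drift f)"
proof (rule integrable_bounded)
  fix x assume x: "x \<in> S"
  have M: "0 \<le> M" using f[of undefined] by linarith
  have "\<bar>drift f x\<bar> \<le> (\<Sum>z\<in>rcpb_targets n x. \<bar>rcpb_rate n lam c \<mu> x z * (f z - f x)\<bar>)"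
    unfolding drift_eq by (rule sum_abs)
  also have "\<dots> \<le> (\<Sum>z\<in>rcpb_targets n x. rcpb_rate n lam c \<mu> x z * (2 * M))"
  proof (rule sum_mono)
    fix z
    have "\<bar>f z - f x\<bar> \<le> 2 * M" using f[of z] f[of x] by linarith
    then show "\<bar>rcpb_rate n lam c \<mu> x z * (f z - f x)\<bar> \<le> rcpb_rate n lam c \<mu> x z * (2 * M)"
      using rcpb_rate_nonneg[OF x, of z] by (simp add: abs_mult mult_left_mono)
  qed
  also have "\<dots> \<le> exit_bound * (2 * M)"
    unfolding sum_distrib_right[symmetric] using exit_rate_le[OF x] M by (intro mult_right_mono) auto
  finally show "\<bar>drift f x\<bar> \<le> exit_bound * (2 * M)" .
qed

text \<open>The form in which drift identities are applied: a pointwise inequality modulo a drift becomes an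
  inequality of expectations.\<close>

lemma expect_le_by_drift:
  assumes f: "\<And>x. \<bar>f x\<bar> \<le> M" and "integrable \<pi> u" "integrable \<pi> v"
    and "\<And>x. x \<in> S \<Longrightarrow> u x \<le> v x + drift f x"
  shows "expect u \<le> expect v"
proof -
  have "expect u \<le> expect (\<lambda>x. v x + drift f x)"
    by (rule expect_mono) (use assms integrable_drift[OF f] in auto)
  also have "\<dots> = expect v"
    using assms integrable_drift[OF f] expect_drift[OF f] by simp
  finally show ?thesis .
qed

text \<open>A token sends the job to some idle server, whichever it is, so only the increment from \<open>0\<close> to \<open>1\<close>
  occurs while tokens are stored.\<close>

lemma drift_separable:
  assumes x: "(q, m) \<in> S"
  shows "drift (\<lambda>x. \<Sum>i<n. \<phi> (fst x i)) (q, m) =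
    lam * (if m = 0 then \<Sum>i<n. \<phi> (Suc (q i)) - \<phi> (q i) else real n * (\<phi> 1 - \<phi> 0))
    + (\<Sum>i<n. of_bool (q i > 0) * (\<phi> (q i - 1) - \<phi> (q i)))"
proof -
  have upd: "(\<Sum>j<n. \<phi> ((q(i := v)) j)) - (\<Sum>j<n. \<phi> (q j)) = \<phi> v - \<phi> (q i)" if "i < n" for i v
  proof -
    have "(\<Sum>j\<in>{..<n} - {i}. \<phi> ((q(i := v)) j)) = (\<Sum>j\<in>{..<n} - {i}. \<phi> (q j))"
      by (rule sum.cong) auto
    then show ?thesis using that by (simp add: sum.remove[of "{..<n}" i])
  qed
  have "(\<Sum>i<n. (if m = 0 then lam else real n * lam * of_bool (q i = 0) / real (num_idle n q))
        * (\<phi> (q i + 1) - \<phi> (q i)))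
      = lam * (if m = 0 then \<Sum>i<n. \<phi> (Suc (q i)) - \<phi> (q i) else real n * (\<phi> 1 - \<phi> 0))"
  proof (cases "m = 0")
    case False
    have "(\<Sum>i<n. real n * lam * of_bool (q i = 0) / real (num_idle n q) * (\<phi> (q i + 1) - \<phi> (q i)))
        = (\<Sum>i<n. real n * lam * of_bool (q i = 0) / real (num_idle n q)) * (\<phi> 1 - \<phi> 0)"
      unfolding sum_distrib_right by (intro sum.cong) (auto simp: of_bool_def)
    then show ?thesis using sum_arrival_rates[OF x] False by simp
  qed (simp add: sum_distrib_left)
  moreover have "(\<Sum>i<n. (if m = 0 then lam else real n * lam * of_bool (q i = 0) / real (num_idle n q))
        * ((\<Sum>j<n. \<phi> ((q(i := q i + 1)) j)) - (\<Sum>j<n. \<phi> (q j))))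
      = (\<Sum>i<n. (if m = 0 then lam else real n * lam * of_bool (q i = 0) / real (num_idle n q))
        * (\<phi> (q i + 1) - \<phi> (q i)))"
    by (intro sum.cong refl arg_cong2[where f="(*)"] upd) simp
  moreover have "(\<Sum>i<n. of_bool (q i > 0) * ((\<Sum>j<n. \<phi> ((q(i := q i - 1)) j)) - (\<Sum>j<n. \<phi> (q j))))
      = (\<Sum>i<n. of_bool (q i > 0) * (\<phi> (q i - 1) - \<phi> (q i)))"
    by (intro sum.cong refl arg_cong2[where f="(*)"] upd) simp
  ultimately show ?thesis
    unfolding rcpb_drift_def prod.case fst_conv by simp
qed

text \<open>Rate balance for \<open>\<Sum>\<^sub>i \<phi>(q\<^sub>i)\<close>, where \<open>b\<close> is the increment of \<open>\<phi>\<close>. A finitely supported \<open>b\<close> keeps \<open>\<phi>\<close>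
  bounded, and thus replaces a truncation argument for functions that grow polynomially.\<close>

lemma truncated_rate_balance:
  assumes b: "b 0 = 0" "\<And>k. 0 \<le> b k" "\<And>k. k > K \<Longrightarrow> b k = 0"
  shows "expect (\<lambda>x. \<Sum>i<n. b (fst x i)) =
    lam * expect (\<lambda>x. if tokens x = 0 then \<Sum>i<n. b (Suc (fst x i)) else real n * b 1)"
proof -
  define \<phi> where "\<phi> k = (\<Sum>j<k. b (Suc j))" for k
  define C where "C = (\<Sum>j<K. b (Suc j))"
  have C: "b k \<le> C" "0 \<le> C" for k
  proof -
    show "0 \<le> C" unfolding C_def by (intro sum_nonneg) (use b in auto)
    then show "b k \<le> C"
      unfolding C_def using b member_le_sum[of "k - 1" "{..<K}" "\<lambda>j. b (Suc j)"]
      by (cases "k > K \<or> k = 0") (auto simp: C_def)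
  qed
  have bK: "i < K" if "b (Suc i) \<noteq> 0" for i
    using b(3)[of "Suc i"] that by fastforce
  have phi: "\<bar>\<phi> k\<bar> \<le> C" for k
  proof -
    have "\<phi> k = (\<Sum>j\<in>{..<k} \<inter> {..<K}. b (Suc j))"
      unfolding \<phi>_def by (rule sum.mono_neutral_right) (use bK in auto)
    also have "\<dots> \<le> C"
      unfolding C_def by (rule sum_mono2) (use b in auto)
    finally have "\<phi> k \<le> C" .
    moreover have "0 \<le> \<phi> k" unfolding \<phi>_def by (intro sum_nonneg) (use b in auto)
    ultimately show ?thesis by simp
  qed
  have bnd: "\<bar>\<Sum>i<n. g i\<bar> \<le> real n * C" if "\<And>i. \<bar>g i\<bar> \<le> C" for g :: "nat \<Rightarrow> real"
  proof -
    have "\<bar>\<Sum>i<n. g i\<bar> \<le> (\<Sum>i<n. \<bar>g i\<bar>)" by (rule sum_abs)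
    also have "\<dots> \<le> real (card {..<n}) * C" by (rule sum_bounded_above) (rule that)
    finally show ?thesis by simp
  qed
  let ?u = "\<lambda>x. \<Sum>i<n. b (fst x i)"
  let ?v = "\<lambda>x. if tokens x = 0 then \<Sum>i<n. b (Suc (fst x i)) else real n * b 1"
  let ?f = "\<lambda>x. \<Sum>i<n. \<phi> (fst x i)"
  have int: "integrable \<pi> ?u" "integrable \<pi> ?v"
    by (rule integrable_bounded[where B="real n * C"], use bnd b C in \<open>auto simp: abs_mult mult_left_mono\<close>)+
  have "drift ?f x = lam * ?v x - ?u x" if "x \<in> S" for x
  proof -
    obtain q m where x: "x = (q, m)" by fastforce
    have "of_bool (k > 0) * (\<phi> (k - 1) - \<phi> k) = - b k" for k
      by (cases k) (auto simp: \<phi>_def b)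
    then show ?thesis
      using drift_separable[of q m \<phi>] that unfolding x
      by (simp add: sum_negf) (simp add: \<phi>_def)
  qed
  then have "expect (drift ?f) = expect (\<lambda>x. lam * ?v x - ?u x)"
    by (intro integral_cong_AE) (use AE_states in auto)
  moreover have "expect (drift ?f) = 0"
    by (rule expect_drift[where M="real n * C"]) (rule bnd, rule phi)
  ultimately show ?thesis using int by simp
qed

text \<open>The pair (idle servers, tokens) is Markovian except for departures that empty a queue: their rate \<open>d\<close>
  is the number of queues holding exactly one job.\<close>

lemma drift_idle_tokens:
  assumes x: "(q, m) \<in> S"
  defines "I \<equiv> num_idle n q" and "d \<equiv> (\<Sum>i<n. of_bool (q i = 1))"
  shows "drift (\<lambda>x. g (num_idle n (fst x)) (snd x)) (q, m) =
    lam * (if m = 0 then real I * (g (I - 1) 0 - g I 0) else real n * (g (I - 1) (m - 1) - g I m))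
    + d * (g (I + 1) m - g I m) + \<mu> * (real I - real m) * of_bool (m < c) * (g I (m + 1) - g I m)"
proof -
  have up: "num_idle n (q(i := q i + 1)) = (if q i = 0 then I - 1 else I)" if "i < n" for i
    using num_idle_update[OF that, of q "q i + 1"] unfolding I_def by (cases "q i = 0") auto
  have down: "num_idle n (q(i := q i - 1)) = (if q i = 1 then I + 1 else I)" if "i < n" "q i > 0" for i
    using num_idle_update[OF that(1), of q "q i - 1"] that(2) unfolding I_def by (auto split: if_splits)
  have "(\<Sum>i<n. (if m = 0 then lam else real n * lam * of_bool (q i = 0) / real (num_idle n q))
        * (g (num_idle n (q(i := q i + 1))) (m - 1) - g I m))
      = lam * (if m = 0 then real I * (g (I - 1) 0 - g I 0) else real n * (g (I - 1) (m - 1) - g I m))"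
  proof (cases "m = 0")
    case True
    have "(\<Sum>i<n. lam * (g (num_idle n (q(i := q i + 1))) 0 - g I 0))
        = (\<Sum>i<n. of_bool (q i = 0) * (lam * (g (I - 1) 0 - g I 0)))"
      by (intro sum.cong) (auto simp del: Suc_eq_plus1 simp: up[unfolded Suc_eq_plus1[symmetric]])
    also have "\<dots> = real I * (lam * (g (I - 1) 0 - g I 0))"
      unfolding I_def num_idle_eq_sum sum_distrib_right ..
    finally show ?thesis using True by simp
  next
    case False
    have "(\<Sum>i<n. real n * lam * of_bool (q i = 0) / real (num_idle n q)
          * (g (num_idle n (q(i := q i + 1))) (m - 1) - g I m))
        = (\<Sum>i<n. real n * lam * of_bool (q i = 0) / real (num_idle n q)) * (g (I - 1) (m - 1) - g I m)"
      unfolding sum_distrib_right by (intro sum.cong) (auto simp: up[simplified])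
    then show ?thesis using sum_arrival_rates[OF x] False by simp
  qed
  moreover have "(\<Sum>i<n. of_bool (q i > 0) * (g (num_idle n (q(i := q i - 1))) m - g I m))
      = d * (g (I + 1) m - g I m)"
    unfolding d_def sum_distrib_right
  proof (rule sum.cong[OF refl])
    fix i assume "i \<in> {..<n}"
    then show "of_bool (q i > 0) * (g (num_idle n (q(i := q i - 1))) m - g I m)
        = of_bool (q i = 1) * (g (I + 1) m - g I m)"
      using down[of i] by (cases "q i = 0"; cases "q i = 1") auto
  qed
  ultimately show ?thesis
    unfolding rcpb_drift_def prod.case fst_conv snd_conv I_def by simp
qed

section \<open>Moments of the queue lengths\<close>

lemma integrable_sum_queues:
  fixes b :: "nat \<Rightarrow> real"
  assumes "\<And>k. \<bar>b k\<bar> \<le> B"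
  shows "integrable \<pi> (\<lambda>x. \<Sum>i<n. b (fst x i))"
  by (intro Bochner_Integration.integrable_sum integrable_bounded[where B=B]) (rule assms)

lemma integrable_sum_queues_no_tokens:
  fixes b :: "nat \<Rightarrow> real"
  assumes "\<And>k. \<bar>b k\<bar> \<le> B"
  shows "integrable \<pi> (\<lambda>x. if tokens x = 0 then \<Sum>i<n. b (fst x i) else a)"
proof -
  have B: "0 \<le> B" using assms[of 0] by linarith
  have "integrable \<pi> (\<lambda>x. (\<Sum>i<n. of_bool (tokens x = 0) * b (fst x i)) + of_bool (tokens x \<noteq> 0) * a)"
    by (intro Bochner_Integration.integrable_add Bochner_Integration.integrable_sum integrable_mult_left
        integrable_bounded[where B="B"] integrable_bounded[where B=1]) (use assms B in auto)
  also have "(\<lambda>x. (\<Sum>i<n. of_bool (tokens x = 0) * b (fst x i)) + of_bool (tokens x \<noteq> 0) * a)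
      = (\<lambda>x. if tokens x = 0 then \<Sum>i<n. b (fst x i) else a)"
    by auto
  finally show ?thesis .
qed

text \<open>The \<open>r\<close>-th power sum of the queue lengths, where queues longer than \<open>K\<close> count as empty. Cutting long
  queues off, instead of capping them at \<open>K\<close>, matches the finitely supported increments of
  \<open>truncated_rate_balance\<close>.\<close>

definition jobs_upto :: "nat \<Rightarrow> nat \<Rightarrow> rcpb_state \<Rightarrow> real" where
  "jobs_upto r K x = (\<Sum>i<n. if fst x i \<le> K then real (fst x i) ^ r else 0)"

definition no_token_prob :: real where
  "no_token_prob = expect (\<lambda>x. of_bool (tokens x = 0))"

text \<open>The constant obtained by solving the balance equation of the second moment, after inserting the bound
  \<open>n \<lambda> / (1 - \<lambda>)\<close> for the first.\<close>

definition second_moment_bound :: real where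
  "second_moment_bound = lam * (1 + lam) / (1 - lam)\<^sup>2"

lemma no_token_prob_bounds: "0 \<le> no_token_prob" "no_token_prob \<le> 1"
proof -
  show "0 \<le> no_token_prob" unfolding no_token_prob_def by (rule Bochner_Integration.integral_nonneg) auto
  have "no_token_prob \<le> expect (\<lambda>_. 1)"
    unfolding no_token_prob_def by (rule expect_mono) (auto intro!: integrable_bounded[where B=1])
  then show "no_token_prob \<le> 1" by simp
qed

lemma jobs_upto_nonneg: "0 \<le> jobs_upto r K x"
  unfolding jobs_upto_def by (intro sum_nonneg) auto

lemma integrable_jobs_upto: "integrable \<pi> (jobs_upto r K)"
  unfolding jobs_upto_def
  by (rule integrable_sum_queues[where B="real K ^ r"]) (auto intro: power_mono)

lemma integrable_jobs_upto_no_tokens: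
  "integrable \<pi> (\<lambda>x. of_bool (tokens x = 0) * jobs_upto r K x)"
  by (rule Bochner_Integration.integrable_bound[OF integrable_jobs_upto[of r K]])
    (auto simp: jobs_upto_nonneg)

text \<open>The increments \<open>k\<^sup>r\<close> make the departure side equal to the power sum, at the price of powers of \<open>k + 1\<close>
  on the arrival side.\<close>

lemma jobs_upto_balance:
  assumes r: "r \<ge> 1" and K: "K \<ge> 1"
    and v: "integrable \<pi> v"
    and le: "\<And>x. x \<in> S \<Longrightarrow>
      (if tokens x = 0 then \<Sum>i<n. if fst x i < K then (real (fst x i) + 1) ^ r else 0 else real n) \<le> v x"
  shows "expect (jobs_upto r K) \<le> lam * expect v"
proof -
  define b where "b k = (if k \<le> K then real k ^ r else 0)" for k
  have b: "\<bar>b k\<bar> \<le> real K ^ r" "b 0 = 0" "b 1 = 1" "0 \<le> b k"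
      "b (Suc k) = (if k < K then (real k + 1) ^ r else 0)" for k
    using r K by (auto simp: b_def add.commute intro: power_mono)
  have "expect (jobs_upto r K) = expect (\<lambda>x. \<Sum>i<n. b (fst x i))"
    by (simp add: jobs_upto_def[abs_def] b_def)
  also have "\<dots> = lam * expect (\<lambda>x. if tokens x = 0 then \<Sum>i<n. b (Suc (fst x i)) else real n * b 1)"
    by (rule truncated_rate_balance[where K=K]) (auto simp: b, auto simp: b_def)
  also have "expect (\<lambda>x. if tokens x = 0 then \<Sum>i<n. b (Suc (fst x i)) else real n * b 1) \<le> expect v"
  proof (rule expect_mono[OF integrable_sum_queues_no_tokens[where B="real K ^ r"] v])
    show "\<bar>b (Suc k)\<bar> \<le> real K ^ r" for k by (rule b)
    show "(if tokens x = 0 then \<Sum>i<n. b (Suc (fst x i)) else real n * b 1) \<le> v x" if "x \<in> S" for x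
      using le[OF that] by (simp only: b mult_1_right)
  qed
  finally show ?thesis using lam by simp
qed

text \<open>Only arrivals that find no token can join a busy queue, so the mean number of jobs exceeds the mean
  number \<open>\<lambda>n\<close> of busy servers by at most the contribution of the token-free times.\<close>

lemma expect_jobs_le_no_tokens:
  assumes K: "K \<ge> 1"
  shows "expect (jobs_upto 1 K)
    \<le> lam * (real n + expect (\<lambda>x. of_bool (tokens x = 0) * jobs_upto 1 K x))"
proof -
  have "expect (jobs_upto 1 K)
      \<le> lam * expect (\<lambda>x. real n + of_bool (tokens x = 0) * jobs_upto 1 K x)"
  proof (rule jobs_upto_balance)
    fix x :: rcpb_state
    have "(\<Sum>i<n. if fst x i < K then (real (fst x i) + 1) ^ 1 else 0)
        \<le> (\<Sum>i<n. 1 + (if fst x i \<le> K then real (fst x i) ^ 1 else 0))"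
      by (intro sum_mono) auto
    then show "(if tokens x = 0 then \<Sum>i<n. if fst x i < K then (real (fst x i) + 1) ^ 1 else 0 else real n)
        \<le> real n + of_bool (tokens x = 0) * jobs_upto 1 K x"
      by (simp add: jobs_upto_def sum.distrib del: One_nat_def)
  qed (use K integrable_jobs_upto_no_tokens[of 1 K] in auto)
  then show ?thesis using integrable_jobs_upto_no_tokens[of 1 K] by simp
qed

lemma expect_jobs_le:
  assumes K: "K \<ge> 1"
  shows "expect (jobs_upto 1 K) \<le> real n * lam / (1 - lam)"
proof -
  have "expect (\<lambda>x. of_bool (tokens x = 0) * jobs_upto 1 K x) \<le> expect (jobs_upto 1 K)"
    by (rule expect_mono[OF integrable_jobs_upto_no_tokens integrable_jobs_upto])
      (auto simp: jobs_upto_nonneg)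
  then have "lam * (real n + expect (\<lambda>x. of_bool (tokens x = 0) * jobs_upto 1 K x))
      \<le> lam * (real n + expect (jobs_upto 1 K))"
    using lam by (intro mult_left_mono) auto
  with expect_jobs_le_no_tokens[OF K] have "expect (jobs_upto 1 K) \<le> lam * (real n + expect (jobs_upto 1 K))"
    by linarith
  then show ?thesis using lam by (simp add: field_simps)
qed

lemma expect_square_jobs_le:
  assumes K: "K \<ge> 1"
  shows "expect (jobs_upto 2 K) \<le> real n * second_moment_bound"
proof -
  have "expect (jobs_upto 2 K) \<le> lam * expect (\<lambda>x. real n + (jobs_upto 2 K x + 2 * jobs_upto 1 K x))"
  proof (rule jobs_upto_balance)
    fix x :: rcpb_state
    have "(\<Sum>i<n. if fst x i < K then (real (fst x i) + 1) ^ 2 else 0)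
        \<le> (\<Sum>i<n. 1 + ((if fst x i \<le> K then real (fst x i) ^ 2 else 0)
            + 2 * (if fst x i \<le> K then real (fst x i) ^ 1 else 0)))"
      by (intro sum_mono) (auto simp: power2_eq_square algebra_simps)
    then show "(if tokens x = 0 then \<Sum>i<n. if fst x i < K then (real (fst x i) + 1) ^ 2 else 0 else real n)
        \<le> real n + (jobs_upto 2 K x + 2 * jobs_upto 1 K x)"
      using jobs_upto_nonneg[of 2 K x] jobs_upto_nonneg[of 1 K x]
      unfolding jobs_upto_def sum.distrib sum_distrib_left[symmetric] by simp
  qed (use K integrable_jobs_upto in auto)
  also have "\<dots> = lam * (real n + (expect (jobs_upto 2 K) + 2 * expect (jobs_upto 1 K)))"
    using integrable_jobs_upto[of 2 K] integrable_jobs_upto[of 1 K] by simp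
  also have "\<dots> \<le> lam * (real n + (expect (jobs_upto 2 K) + 2 * (real n * lam / (1 - lam))))"
    using expect_jobs_le[OF K] lam by (intro mult_left_mono add_left_mono) auto
  finally have "(1 - lam) * expect (jobs_upto 2 K) \<le> lam * (real n + 2 * (real n * lam / (1 - lam)))"
    by (simp add: algebra_simps)
  also have "\<dots> = (1 - lam) * (real n * second_moment_bound)"
    using lam by (simp add: second_moment_bound_def power2_eq_square divide_simps) (simp add: algebra_simps)
  finally show ?thesis using lam by simp
qed

text \<open>By \<open>k \<le> k\<^sup>2/L + L\<close>, the jobs present at token-free times are bounded by the second moment and by the
  token-free probability. The free parameter \<open>L\<close> is chosen once both are known.\<close>

lemma expect_jobs_le_no_token_prob:
  assumes K: "K \<ge> 1" and L: "L > 0"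
  shows "expect (jobs_upto 1 K)
    \<le> real n * (lam * (1 + second_moment_bound / L + L * no_token_prob))"
proof -
  have "expect (\<lambda>x. of_bool (tokens x = 0) * jobs_upto 1 K x)
      \<le> expect (\<lambda>x. jobs_upto 2 K x / L + real n * L * of_bool (tokens x = 0))"
  proof (rule expect_mono)
    fix x
    have "real k \<le> real k ^ 2 / L + L" for k
    proof -
      have "0 \<le> (real k - L)\<^sup>2 + real k * L" using L by simp
      then have "real k * L \<le> real k ^ 2 + L * L" by (simp add: power2_eq_square algebra_simps)
      then show ?thesis using L by (simp add: field_simps)
    qed
    then have "jobs_upto 1 K x \<le> (\<Sum>i<n. (if fst x i \<le> K then real (fst x i) ^ 2 else 0) / L + L)"
      unfolding jobs_upto_def using L by (intro sum_mono) auto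
    also have "\<dots> = jobs_upto 2 K x / L + real n * L"
      by (simp add: jobs_upto_def sum.distrib sum_divide_distrib)
    finally show "of_bool (tokens x = 0) * jobs_upto 1 K x
        \<le> jobs_upto 2 K x / L + real n * L * of_bool (tokens x = 0)"
      using L jobs_upto_nonneg[of 2 K x] by auto
    show "integrable \<pi> (\<lambda>x. jobs_upto 2 K x / L + real n * L * of_bool (tokens x = 0))"
      by (intro Bochner_Integration.integrable_add integrable_mult_right integrable_divide
          integrable_jobs_upto integrable_bounded[where B=1]) auto
  qed (rule integrable_jobs_upto_no_tokens)
  also have "\<dots> = expect (jobs_upto 2 K) / L + real n * L * no_token_prob"
    using integrable_jobs_upto[of 2 K]
    by (subst Bochner_Integration.integral_add)
      (auto simp: no_token_prob_def intro!: integrable_mult_right integrable_bounded[where B=1])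
  also have "\<dots> \<le> real n * second_moment_bound / L + real n * L * no_token_prob"
    using expect_square_jobs_le[OF K] L by (intro add_right_mono divide_right_mono) auto
  finally have "lam * (real n + expect (\<lambda>x. of_bool (tokens x = 0) * jobs_upto 1 K x))
      \<le> lam * (real n + (real n * second_moment_bound / L + real n * L * no_token_prob))"
    using lam by (intro mult_left_mono) auto
  with expect_jobs_le_no_tokens[OF K] show ?thesis by (simp add: algebra_simps)
qed

lemma busy_eq: "real n - idle x = (\<Sum>i<n. of_bool (fst x i > 0))"
proof -
  have "real n = (\<Sum>i<n. of_bool (fst x i = 0) + of_bool (fst x i > 0))"
    by (subst sum.cong[OF refl, of _ _ "\<lambda>_. 1"]) auto
  then show ?thesis unfolding num_idle_eq_sum sum.distrib by linarith
qed

lemma idle_bounds: "0 \<le> idle x" "idle x \<le> real n"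
  using num_idle_le by auto

lemma integrable_idle: "integrable \<pi> idle"
  by (rule integrable_bounded[where B="real n"]) (use idle_bounds in auto)

text \<open>On average a fraction \<open>\<lambda>\<close> of the servers is busy: the increment \<open>1\<close> for lengths between \<open>1\<close> and \<open>K\<close>
  balances arrivals against busy servers, up to queues longer than \<open>K\<close>, which disappear as \<open>K \<rightarrow> \<infinity>\<close>.\<close>

lemma expect_idle: "expect idle = real n * (1 - lam)"
proof -
  define b where "b K k = (of_bool (1 \<le> k \<and> k \<le> K) :: real)" for K k :: nat
  let ?u = "\<lambda>K x. \<Sum>i<n. (b K (fst x i) :: real)"
  let ?v = "\<lambda>K x. if tokens x = 0 then \<Sum>i<n. (b K (Suc (fst x i)) :: real) else real n"
  have bnd: "0 \<le> (\<Sum>i<n. (b K (g i) :: real))" "(\<Sum>i<n. (b K (g i) :: real)) \<le> real n" for K g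
    using sum_bounded_above[of "{..<n}" "\<lambda>i. b K (g i) :: real" 1]
    by (auto simp: b_def intro: sum_nonneg)
  have eq: "expect (?u (Suc K)) = lam * expect (?v (Suc K))" for K
  proof -
    have "expect (?u (Suc K)) = lam * expect (\<lambda>x. if tokens x = 0 then \<Sum>i<n. b (Suc K) (Suc (fst x i)) else real n * b (Suc K) 1)"
      by (rule truncated_rate_balance[where K="Suc K"]) (auto simp: b_def)
    moreover have "b (Suc K) 1 = 1" by (simp add: b_def)
    ultimately show ?thesis by (simp only: mult_1_right)
  qed
  have b_lim: "(\<lambda>K. b (Suc K) k :: real) \<longlonglongrightarrow> of_bool (k > 0)" for k
    by (rule tendsto_eventually) (auto simp: b_def eventually_sequentially intro!: exI[of _ k])
  have u: "(\<lambda>K. expect (?u (Suc K))) \<longlonglongrightarrow> expect (\<lambda>x. real n - idle x)"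
    unfolding busy_eq
  proof (rule integral_dominated_convergence[where w="\<lambda>_. real n"])
    show "AE x in measure_pmf \<pi>. (\<lambda>K. ?u (Suc K) x) \<longlonglongrightarrow> (\<Sum>i<n. of_bool (fst x i > 0))"
      by (intro AE_I2 tendsto_sum b_lim)
  qed (use bnd in auto)
  have v: "(\<lambda>K. expect (?v (Suc K))) \<longlonglongrightarrow> expect (\<lambda>_. real n)"
  proof (rule integral_dominated_convergence[where w="\<lambda>_. real n"])
    have "(\<lambda>K. \<Sum>i<n. b (Suc K) (Suc (g i)) :: real) \<longlonglongrightarrow> (\<Sum>i<n. of_bool (Suc (g i) > 0))" for g
      by (intro tendsto_sum b_lim)
    then have "(\<lambda>K. ?v (Suc K) x) \<longlonglongrightarrow> real n" for x :: rcpb_state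
      by (cases "tokens x = 0") simp_all
    then show "AE x in measure_pmf \<pi>. (\<lambda>K. ?v (Suc K) x) \<longlonglongrightarrow> real n"
      by (rule AE_I2)
  qed (use bnd in auto)
  have "expect (\<lambda>x. real n - idle x) = lam * expect (\<lambda>_. real n)"
    by (rule LIMSEQ_unique[OF u]) (use tendsto_mult_left[OF v, of lam] in \<open>simp add: eq\<close>)
  then show ?thesis using integrable_idle by (simp add: algebra_simps)
qed

section \<open>Concentration of the idle fraction\<close>

definition excess_idle :: "nat \<Rightarrow> real" where
  "excess_idle I = max 0 (real I / real n - (1 - lam))"

lemma excess_idle_bounds: "0 \<le> excess_idle I" "I \<le> n \<Longrightarrow> excess_idle I \<le> 1"
proof -
  assume "I \<le> n"
  then have "real I / real n \<le> 1" using n_pos by simp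
  then show "excess_idle I \<le> 1" using lam by (simp add: excess_idle_def)
qed (simp add: excess_idle_def)

lemma excess_idle_0: "excess_idle 0 = 0"
  using lam by (simp add: excess_idle_def)

lemma excess_idle_mono: "mono excess_idle"
  unfolding excess_idle_def by (intro monoI max.mono diff_right_mono divide_right_mono) auto

lemma excess_idle_Suc: "excess_idle (Suc I) \<le> excess_idle I + 1 / real n"
  by (auto simp: excess_idle_def max_def add_divide_distrib)

lemma excess_idle_square: "real n * (excess_idle I)\<^sup>2 = excess_idle I * (real I - real n * (1 - lam))"
  using n_pos by (auto simp: excess_idle_def max_def power2_eq_square field_simps)

lemma single_job_queues_le:
  "0 \<le> (\<Sum>i<n. of_bool (q i = 1) :: real)" "(\<Sum>i<n. of_bool (q i = 1)) \<le> real n - real (num_idle n q)"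
proof -
  have "(\<Sum>i<n. of_bool (q i = 1)) \<le> (\<Sum>i<n. of_bool (q i > 0) :: real)"
    by (intro sum_mono) auto
  then show "(\<Sum>i<n. of_bool (q i = 1)) \<le> real n - real (num_idle n q)"
    using busy_eq[of "(q, 0)"] by simp
qed (auto intro: sum_nonneg)

lemma integrable_weighted_idle:
  fixes w :: "nat \<Rightarrow> real"
  assumes "\<And>I. I \<le> n \<Longrightarrow> \<bar>w I\<bar> \<le> B"
  shows "integrable \<pi> (\<lambda>x. w (num_idle n (fst x)))"
    and "integrable \<pi> (\<lambda>x. of_bool (tokens x = k) * w (num_idle n (fst x)))"
proof -
  have "0 \<le> B" using assms[of 0] by auto
  then show "integrable \<pi> (\<lambda>x. w (num_idle n (fst x)))"
    and "integrable \<pi> (\<lambda>x. of_bool (tokens x = k) * w (num_idle n (fst x)))"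
    by (auto intro!: integrable_bounded[where B=B] assms num_idle_le simp: abs_mult)
qed

text \<open>With \<open>h\<close> an antiderivative of \<open>w\<close> in the number of idle servers, an arrival contributes \<open>\<lambda>n w\<close> when a
  token is stored, and departures contribute at most \<open>(n - I) w + 1\<close>, because at most \<open>n - I\<close> queues can
  become empty and \<open>w\<close> increases by at most \<open>1/n\<close>. The difference is \<open>w (I - n (1 - \<lambda>)) = n w\<^sup>2\<close>, up to
  the token-free times.\<close>

lemma expect_excess_square_le:
  "expect (\<lambda>x. (excess_idle (num_idle n (fst x)))\<^sup>2)
    \<le> lam * expect (\<lambda>x. of_bool (tokens x = 0) * excess_idle (num_idle n (fst x))) + 1 / real n"
proof -
  let ?w = excess_idle and ?I = "\<lambda>x. num_idle n (fst x)"
  \<comment> \<open>The sign is negative so that the drift bounds the square from above.\<close>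
  define h where "h I = - (\<Sum>j<I. ?w (Suc j))" for I
  let ?f = "\<lambda>x :: rcpb_state. h (?I x)"
  have w: "\<bar>?w I\<bar> \<le> 1" "\<bar>(?w I)\<^sup>2\<bar> \<le> 1" if "I \<le> n" for I
    using excess_idle_bounds[of I] that by (auto intro: power_le_one)
  have int: "integrable \<pi> (\<lambda>x. of_bool (tokens x = 0) * ?w (?I x))" "integrable \<pi> (\<lambda>x. (?w (?I x))\<^sup>2)"
    using integrable_weighted_idle[of ?w 1] integrable_weighted_idle[of "\<lambda>I. (?w I)\<^sup>2" 1] w by auto
  have h: "h (I - 1) - h I = ?w I" "h (I + 1) - h I = - ?w (Suc I)" for I
    using excess_idle_0 by (cases I; simp add: h_def)+
  have "\<bar>?f x\<bar> \<le> real n" for x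
  proof -
    have "(\<Sum>j<?I x. ?w (Suc j)) \<le> real (card {..<?I x}) * 1"
      using num_idle_le[of n "fst x"] by (intro sum_bounded_above excess_idle_bounds) auto
    moreover have "0 \<le> (\<Sum>j<?I x. ?w (Suc j))"
      by (intro sum_nonneg excess_idle_bounds)
    ultimately show ?thesis using idle_bounds[of x] by (simp add: h_def)
  qed
  then have "expect (\<lambda>x. real n * (?w (?I x))\<^sup>2)
      \<le> expect (\<lambda>x. lam * real n * (of_bool (tokens x = 0) * ?w (?I x)) + 1)"
  proof (rule expect_le_by_drift)
    fix x assume x: "x \<in> S"
    obtain q m where xq: "x = (q, m)" by fastforce
    define I where "I = num_idle n q"
    define d where "d = (\<Sum>i<n. of_bool (q i = 1) :: real)"
    have d: "0 \<le> d" "d \<le> real n - real I"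
      using single_job_queues_le[of q] by (auto simp: d_def I_def)
    have w0: "0 \<le> ?w I" by (rule excess_idle_bounds)
    have "drift ?f x = lam * (if m = 0 then real I * ?w I else real n * ?w I) - d * ?w (Suc I)"
      using drift_idle_tokens[of q m "\<lambda>I m. h I"] x unfolding xq h I_def d_def by simp
    moreover have "d * ?w (Suc I) \<le> (real n - real I) * ?w I + 1"
    proof -
      have "d * ?w (Suc I) \<le> (real n - real I) * (?w I + 1 / real n)"
        using d excess_idle_Suc[of I] excess_idle_bounds[of "Suc I"] by (intro mult_mono) auto
      also have "\<dots> \<le> (real n - real I) * ?w I + 1"
        using n_pos by (simp add: field_simps)
      finally show ?thesis .
    qed
    moreover have "0 \<le> lam * (real I * ?w I)" using lam w0 by simp
    ultimately show "real n * (?w (?I x))\<^sup>2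
        \<le> lam * real n * (of_bool (tokens x = 0) * ?w (?I x)) + 1 + drift ?f x"
      unfolding excess_idle_square xq by (cases "m = 0") (auto simp: I_def algebra_simps)
  qed (use int in auto)
  then have "real n * expect (\<lambda>x. (?w (?I x))\<^sup>2)
      \<le> lam * real n * expect (\<lambda>x. of_bool (tokens x = 0) * ?w (?I x)) + 1"
    using int by simp
  then show ?thesis using n_pos by (simp add: field_simps)
qed

lemma expect_excess_le:
  "expect (\<lambda>x. excess_idle (num_idle n (fst x)))
    \<le> sqrt (lam * expect (\<lambda>x. of_bool (tokens x = 0) * excess_idle (num_idle n (fst x))) + 1 / real n)"
proof (rule real_le_rsqrt)
  let ?w = "\<lambda>x. excess_idle (num_idle n (fst x))"
  have w: "\<bar>excess_idle I\<bar> \<le> 1" "\<bar>(excess_idle I)\<^sup>2\<bar> \<le> 1" if "I \<le> n" for I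
    using excess_idle_bounds[of I] that by (auto intro: power_le_one)
  have "0 \<le> expect (\<lambda>x. (?w x - expect ?w)\<^sup>2)" by (rule measure_pmf.variance_positive)
  also have "\<dots> = expect (\<lambda>x. (?w x)\<^sup>2) - (expect ?w)\<^sup>2"
    using integrable_weighted_idle[of excess_idle 1] integrable_weighted_idle[of "\<lambda>I. (excess_idle I)\<^sup>2" 1] w
    by (intro measure_pmf.variance_eq) auto
  finally show "(expect ?w)\<^sup>2 \<le> lam * expect (\<lambda>x. of_bool (tokens x = 0) * ?w x) + 1 / real n"
    using expect_excess_square_le by linarith
qed

section \<open>How often no token is stored\<close>

lemma abs_shift_le: "I \<le> n \<Longrightarrow> \<bar>real I - real k\<bar> \<le> real n + real k"
  by linarith

text \<open>Flow balance across the cut between token levels \<open>k\<close> and \<open>k + 1\<close>, from the drift of \<open>w(I) 1{m > k}\<close>.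
  Monotonicity of \<open>w\<close> makes the contribution of departures favourable, and the Lipschitz bound limits the
  loss through arrivals above the cut to \<open>\<lambda>\<close>, which is negligible compared to \<open>n\<close>.\<close>

lemma token_level_cut:
  fixes w :: "nat \<Rightarrow> real"
  assumes w: "mono w" "\<And>I. 0 \<le> w I" "\<And>I. I \<le> n \<Longrightarrow> w I \<le> 1"
      "\<And>I. w (Suc I) \<le> w I + 1 / real n"
    and k: "k < c"
  shows "\<mu> * expect (\<lambda>x. of_bool (tokens x = k) * ((idle x - real k) * w (num_idle n (fst x))))
    \<le> real n * lam * expect (\<lambda>x. of_bool (tokens x = k + 1) * w (num_idle n (fst x))) + lam"
proof -
  let ?I = "\<lambda>x. num_idle n (fst x)"
  define g where "g I m = w I * of_bool (m > k)" for I m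
  have absw: "\<bar>w I\<bar> \<le> 1" if "I \<le> n" for I using w(2,3)[of I] that by auto
  have absIw: "\<bar>(real I - real k) * w I\<bar> \<le> real n + real k" if "I \<le> n" for I
    using mult_mono[OF abs_shift_le[OF that, of k] absw[OF that]] by (simp add: abs_mult)
  have int: "integrable \<pi> (\<lambda>x. of_bool (tokens x = k + 1) * w (?I x))"
      "integrable \<pi> (\<lambda>x. of_bool (tokens x = k) * ((idle x - real k) * w (?I x)))"
    using integrable_weighted_idle[of w 1] integrable_weighted_idle[of "\<lambda>I. (real I - real k) * w I"] absw absIw
    by auto
  have "expect (\<lambda>x. \<mu> * (of_bool (tokens x = k) * ((idle x - real k) * w (?I x))))
      \<le> expect (\<lambda>x. real n * lam * (of_bool (tokens x = k + 1) * w (?I x)) + lam)"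
  proof (rule expect_le_by_drift[where f="\<lambda>x. g (?I x) (snd x)" and M=1])
    show "\<bar>g (?I x) (snd x)\<bar> \<le> 1" for x
      using absw[OF num_idle_le] by (auto simp: g_def)
  next
    fix x assume x: "x \<in> S"
    obtain q m where xq: "x = (q, m)" by fastforce
    define I where "I = num_idle n q"
    define d where "d = (\<Sum>i<n. of_bool (q i = 1) :: real)"
    have d: "0 \<le> d" using single_job_queues_le[of q] by (auto simp: d_def)
    have "0 \<le> d * (w (I + 1) - w I)"
      using d monoD[OF w(1), of I "I + 1"] by auto
    moreover have "lam * (real n * (w I - w (I - 1))) \<le> lam"
    proof -
      have "real n * (w I - w (I - 1)) \<le> 1"
        using w(4)[of "I - 1"] n_pos by (cases I) (auto simp: field_simps)
      then show ?thesis using lam by simp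
    qed
    moreover have "drift (\<lambda>x. g (?I x) (snd x)) x =
        lam * (if m = 0 then real I * (g (I - 1) 0 - g I 0) else real n * (g (I - 1) (m - 1) - g I m))
        + d * (g (I + 1) m - g I m) + \<mu> * (real I - real m) * of_bool (m < c) * (g I (m + 1) - g I m)"
      using drift_idle_tokens[of q m g] x unfolding xq I_def d_def by simp
    ultimately show "\<mu> * (of_bool (tokens x = k) * ((idle x - real k) * w (?I x)))
        \<le> real n * lam * (of_bool (tokens x = k + 1) * w (?I x)) + lam + drift (\<lambda>x. g (?I x) (snd x)) x"
      using k lam unfolding xq fst_conv snd_conv I_def[symmetric]
      by (cases "m < k"; cases "m = k"; cases "m = k + 1")
        (auto simp: g_def algebra_simps less_diff_conv)
  qed (use int in auto)
  then show ?thesis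
    using int by simp
qed

text \<open>On the support of \<open>w\<close> the creation rate of tokens is at least the consumption rate \<open>\<lambda>n\<close>, up to the
  deficit of idle servers measured by \<open>\<delta>\<close>. Hence the weights of successive token levels decrease by at
  most a small \<open>\<epsilon>\<close> along the first \<open>K\<close> levels. As these weights sum to at most \<open>1\<close>, the first one is at
  most \<open>1/K + K \<epsilon>\<close>.\<close>

lemma no_tokens_le_by_cuts:
  fixes w :: "nat \<Rightarrow> real"
  assumes w: "mono w" "\<And>I. 0 \<le> w I" "\<And>I. I \<le> n \<Longrightarrow> w I \<le> 1"
      "\<And>I. w (Suc I) \<le> w I + 1 / real n"
    and K: "1 \<le> K" "K \<le> c" and crit: "lam \<le> \<mu> * (1 - lam)"
    and \<delta>: "expect (\<lambda>x. w (num_idle n (fst x)) * max 0 (real n * (1 - lam) - idle x)) \<le> real n * \<delta>"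
  shows "expect (\<lambda>x. of_bool (tokens x = 0) * w (num_idle n (fst x)))
    \<le> 1 / real K + real K * ((lam + \<mu> * real K) / lam * (1 / real n) + \<mu> / lam * \<delta>)"
proof -
  let ?I = "\<lambda>x. num_idle n (fst x)"
  define a where "a k = expect (\<lambda>x. of_bool (tokens x = k) * w (?I x))" for k
  define \<epsilon> where "\<epsilon> = (lam + \<mu> * real K) / lam * (1 / real n) + \<mu> / lam * \<delta>"
  have absw: "\<bar>w I\<bar> \<le> 1" if "I \<le> n" for I using w(2,3)[of I] that by auto
  have int: "integrable \<pi> (\<lambda>x. of_bool (tokens x = k) * w (?I x))" for k
    by (rule integrable_weighted_idle[OF absw])
  have absIw: "\<bar>(real I - real k) * w I\<bar> \<le> real n + real k" if "I \<le> n" for I k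
    using mult_mono[OF abs_shift_le[OF that, of k] absw[OF that]] by (simp add: abs_mult)
  have absdef: "\<bar>w I * max 0 (real n * (1 - lam) - real I)\<bar> \<le> real n" if "I \<le> n" for I
  proof -
    have "max 0 (real n * (1 - lam) - real I) \<le> real n"
      using lam by (auto simp: algebra_simps intro: add_increasing)
    then have "w I * max 0 (real n * (1 - lam) - real I) \<le> 1 * real n"
      using w(3)[OF that] by (intro mult_mono) auto
    then show ?thesis using w(2) by simp
  qed
  have step: "a k \<le> a (k + 1) + \<epsilon>" if k: "k < K" for k
  proof -
    let ?def = "\<lambda>x. w (?I x) * max 0 (real n * (1 - lam) - idle x)"
    have int': "integrable \<pi> (\<lambda>x. of_bool (tokens x = k) * ((idle x - real k) * w (?I x)))" "integrable \<pi> ?def"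
      using integrable_weighted_idle(2)[of "\<lambda>I. (real I - real k) * w I" "real n + real k" k, OF absIw]
        integrable_weighted_idle(1)[of "\<lambda>I. w I * max 0 (real n * (1 - lam) - real I)" "real n", OF absdef]
      by simp_all
    have "expect (\<lambda>x. real n * lam * (of_bool (tokens x = k) * w (?I x)))
      \<le> expect (\<lambda>x. \<mu> * (of_bool (tokens x = k) * ((idle x - real k) * w (?I x)) + (real K + ?def x)))"
    proof (rule expect_mono)
      fix x assume x: "x \<in> S"
      have w0: "0 \<le> w (?I x)" "w (?I x) \<le> 1" using w num_idle_le by auto
      have nl: "real n * lam \<le> \<mu> * (real n * (1 - lam))"
        using mult_left_mono[OF crit, of "real n"] by (simp add: algebra_simps)
      have "real n * lam * w (?I x) \<le> \<mu> * ((real n * (1 - lam)) * w (?I x))"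
        using mult_right_mono[OF nl w0(1)] by (simp add: mult.assoc)
      also have "\<dots> \<le> \<mu> * ((idle x - real k) * w (?I x) + (real K + ?def x))"
      proof (rule mult_left_mono)
        have "(real n * (1 - lam) - idle x) * w (?I x) \<le> ?def x"
          using w0 by (subst mult.commute) (intro mult_left_mono, auto)
        moreover have "real k * w (?I x) \<le> real K * 1"
          using w0 k by (intro mult_mono) auto
        ultimately show "(real n * (1 - lam)) * w (?I x) \<le> (idle x - real k) * w (?I x) + (real K + ?def x)"
          by (simp add: algebra_simps)
      qed (use mu in simp)
      finally have "real n * lam * w (?I x) \<le> \<mu> * ((idle x - real k) * w (?I x) + (real K + ?def x))" .
      moreover have "0 \<le> \<mu> * (real K + ?def x)" using mu w0 by simp
      ultimately show "real n * lam * (of_bool (tokens x = k) * w (?I x))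
          \<le> \<mu> * (of_bool (tokens x = k) * ((idle x - real k) * w (?I x)) + (real K + ?def x))"
        by (auto simp: of_bool_def)
    qed (use int[of k] int' in auto)
    also have "\<dots> = \<mu> * expect (\<lambda>x. of_bool (tokens x = k) * ((idle x - real k) * w (?I x)))
        + \<mu> * (real K + expect ?def)"
      using int' by (simp add: distrib_left)
    also have "\<dots> \<le> (real n * lam * a (k + 1) + lam) + \<mu> * (real K + real n * \<delta>)"
      using token_level_cut[OF w, of k] k K \<delta> mu unfolding a_def by (intro add_mono mult_left_mono) auto
    finally have "real n * lam * a k \<le> real n * lam * a (k + 1) + (lam + \<mu> * (real K + real n * \<delta>))"
      using int[of k] unfolding a_def by simp
    also have "\<dots> = real n * lam * (a (k + 1) + \<epsilon>)"
      using n_pos lam by (simp add: \<epsilon>_def field_simps)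
    finally show ?thesis using n_pos lam by simp
  qed
  have a0: "a 0 \<le> a k + real k * \<epsilon>" if "k < K" for k
    using that
  proof (induction k)
    case (Suc k)
    then show ?case using step[of k] by (simp add: algebra_simps)
  qed simp
  have "0 \<le> a k" for k
    unfolding a_def by (intro Bochner_Integration.integral_nonneg) (use w in auto)
  have "\<delta> \<ge> 0"
  proof -
    have "0 \<le> real n * \<delta>"
      by (rule order_trans[OF _ \<delta>], rule Bochner_Integration.integral_nonneg) (use w in auto)
    then show ?thesis using n_pos by (simp add: zero_le_mult_iff)
  qed
  then have \<epsilon>: "0 \<le> \<epsilon>" using lam mu by (simp add: \<epsilon>_def)
  have "real K * a 0 = (\<Sum>k<K. a 0)" by simp
  also have "\<dots> \<le> (\<Sum>k<K. a k + real K * \<epsilon>)"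
  proof (rule sum_mono)
    fix k assume "k \<in> {..<K}"
    then show "a 0 \<le> a k + real K * \<epsilon>"
      using a0[of k] mult_right_mono[of "real k" "real K" \<epsilon>] \<epsilon> by auto
  qed
  also have "\<dots> = (\<Sum>k<K. a k) + real K * (real K * \<epsilon>)"
    by (simp add: sum.distrib)
  also have "(\<Sum>k<K. a k) = expect (\<lambda>x. \<Sum>k<K. of_bool (tokens x = k) * w (?I x))"
    unfolding a_def by (rule Bochner_Integration.integral_sum[symmetric]) (rule int)
  also have "\<dots> \<le> expect (\<lambda>_. 1)"
  proof (rule expect_mono)
    fix x
    have "(\<Sum>k<K. of_bool (tokens x = k)) \<le> (1 :: real)"
      by (simp add: of_bool_def)
    then have "(\<Sum>k<K. of_bool (tokens x = k)) * w (?I x) \<le> 1 * 1"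
      using w num_idle_le by (intro mult_mono) auto
    then show "(\<Sum>k<K. of_bool (tokens x = k) * w (?I x)) \<le> 1"
      by (simp add: sum_distrib_right)
    show "integrable \<pi> (\<lambda>x. \<Sum>k<K. of_bool (tokens x = k) * w (?I x))"
      by (intro Bochner_Integration.integrable_sum int)
  qed simp
  finally have "real K * a 0 \<le> 1 + real K * (real K * \<epsilon>)" by simp
  then have "a 0 \<le> (1 + real K * (real K * \<epsilon>)) / real K"
    using K by (simp add: field_simps)
  also have "\<dots> = 1 / real K + real K * \<epsilon>"
    using K by (simp add: field_simps)
  finally show ?thesis by (simp add: a_def \<epsilon>_def)
qed

text \<open>These two means and the token-free probability are what the limit argument tracks: the second
  vanishes first, then the first, then the probability.\<close>

definition mean_excess_idle :: real where
  "mean_excess_idle = expect (\<lambda>x. excess_idle (num_idle n (fst x)))"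

definition mean_tokenless_excess_idle :: real where
  "mean_tokenless_excess_idle = expect (\<lambda>x. of_bool (tokens x = 0) * excess_idle (num_idle n (fst x)))"

lemma mean_excess_idle_nonneg: "0 \<le> mean_excess_idle" "0 \<le> mean_tokenless_excess_idle"
  unfolding mean_excess_idle_def mean_tokenless_excess_idle_def
  by (intro Bochner_Integration.integral_nonneg; simp add: excess_idle_bounds)+

lemma integrable_excess_idle:
  "integrable \<pi> (\<lambda>x. excess_idle (num_idle n (fst x)))"
  "integrable \<pi> (\<lambda>x. of_bool (tokens x = 0) * excess_idle (num_idle n (fst x)))"
  using integrable_weighted_idle[of excess_idle 1] excess_idle_bounds by auto

text \<open>The idle fraction has mean \<open>1 - \<lambda>\<close>, so its mean excess equals its mean deficit.\<close>

lemma mean_idle_deficit: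
  "expect (\<lambda>x. max 0 (real n * (1 - lam) - idle x)) = real n * mean_excess_idle"
proof -
  have "max 0 (real n * (1 - lam) - idle x)
      = real n * excess_idle (num_idle n (fst x)) + (real n * (1 - lam) - idle x)" for x
    using n_pos by (auto simp: excess_idle_def max_def field_simps)
  then show ?thesis
    using integrable_excess_idle(1) integrable_idle
    by (simp add: mean_excess_idle_def expect_idle)
qed

text \<open>Where the excess is positive there is no deficit, so \<open>\<delta> = 0\<close> is allowed
  before any concentration is known.\<close>

lemma mean_tokenless_excess_idle_le_many_tokens:
  assumes K: "1 \<le> K" "K \<le> c" and crit: "lam \<le> \<mu> * (1 - lam)"
  shows "mean_tokenless_excess_idle
    \<le> 1 / real K + real K * ((lam + \<mu> * real K) / lam * (1 / real n) + \<mu> / lam * 0)"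
  unfolding mean_tokenless_excess_idle_def
proof (rule no_tokens_le_by_cuts[OF excess_idle_mono excess_idle_bounds excess_idle_Suc K crit])
  have "excess_idle I * max 0 (real n * (1 - lam) - real I) = 0" for I
    using n_pos by (auto simp: excess_idle_def max_def field_simps)
  then show "expect (\<lambda>x. excess_idle (num_idle n (fst x)) * max 0 (real n * (1 - lam) - idle x))
      \<le> real n * 0"
    by (simp only: integral_zero mult_zero_right order_refl)
qed

lemma no_token_prob_le_many_tokens:
  assumes K: "1 \<le> K" "K \<le> c" and crit: "lam \<le> \<mu> * (1 - lam)"
  shows "no_token_prob
    \<le> 1 / real K + real K * ((lam + \<mu> * real K) / lam * (1 / real n) + \<mu> / lam * mean_excess_idle)"
  using no_tokens_le_by_cuts[of "\<lambda>_. 1" K mean_excess_idle] K crit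
  by (simp add: no_token_prob_def mean_idle_deficit mono_def)

text \<open>Tokens are created at rate \<open>\<mu> I\<close> at level \<open>0\<close> and consumed at rate \<open>\<lambda>n\<close> at level \<open>1\<close>; so for large \<open>\<mu>\<close> few
  servers can be idle at token-free times.\<close>

lemma expect_tokenless_idle_le:
  "expect (\<lambda>x. of_bool (tokens x = 0) * idle x) \<le> real n * (2 * lam / \<mu>)"
proof -
  have "expect (\<lambda>x. of_bool (tokens x = 1)) \<le> expect (\<lambda>_. 1 :: real)"
    by (rule expect_mono) (auto intro!: integrable_bounded[where B=1])
  then have "real n * lam * expect (\<lambda>x. of_bool (tokens x = 1)) \<le> real n * lam * 1"
    using lam by (intro mult_left_mono) auto
  moreover have "\<mu> * expect (\<lambda>x. of_bool (tokens x = 0) * idle x)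
      \<le> real n * lam * expect (\<lambda>x. of_bool (tokens x = 1)) + lam"
    using token_level_cut[of "\<lambda>_. 1" 0] c by (simp add: mono_def)
  moreover have "lam \<le> real n * lam" using n_pos lam by simp
  ultimately have "\<mu> * expect (\<lambda>x. of_bool (tokens x = 0) * idle x) \<le> real n * (2 * lam)"
    by linarith
  then show ?thesis using mu by (simp add: field_simps)
qed

lemma mean_tokenless_excess_idle_le_fast_messages:
  "mean_tokenless_excess_idle \<le> 2 * lam / \<mu>"
proof -
  have int: "integrable \<pi> (\<lambda>x. of_bool (tokens x = 0) * idle x / real n)"
    using integrable_weighted_idle(2)[of real "real n" 0] by simp
  have "mean_tokenless_excess_idle \<le> expect (\<lambda>x. of_bool (tokens x = 0) * idle x / real n)"
    unfolding mean_tokenless_excess_idle_def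
    by (rule expect_mono[OF integrable_excess_idle(2) int])
      (use lam in \<open>auto simp: excess_idle_def\<close>)
  also have "\<dots> = expect (\<lambda>x. of_bool (tokens x = 0) * idle x) / real n"
    by simp
  also have "\<dots> \<le> real n * (2 * lam / \<mu>) / real n"
    by (intro divide_right_mono expect_tokenless_idle_le) simp
  finally show ?thesis using n_pos by simp
qed

text \<open>Token-free states have either many idle servers, which fast messages make rare, or a deficit of idle
  servers, which concentration makes rare.\<close>

lemma no_token_prob_le_fast_messages:
  "(1 - lam) * no_token_prob \<le> 2 * lam / \<mu> + mean_excess_idle"
proof -
  let ?def = "\<lambda>x. max 0 (real n * (1 - lam) - idle x)"
  have int: "integrable \<pi> (\<lambda>x. of_bool (tokens x = 0) * idle x)"
    using integrable_weighted_idle(2)[of real "real n" 0] by simp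
  have int_def: "integrable \<pi> ?def"
    using integrable_excess_idle(1) integrable_idle
    by (intro integrable_max) auto
  have "expect (\<lambda>x. real n * (1 - lam) * of_bool (tokens x = 0))
      \<le> expect (\<lambda>x. of_bool (tokens x = 0) * idle x + ?def x)"
    by (rule expect_mono)
      (use int int_def in \<open>auto intro!: integrable_mult_right integrable_bounded[where B=1] simp del: of_bool_eq_0_iff\<close>)
  moreover have "expect (\<lambda>x. real n * (1 - lam) * of_bool (tokens x = 0)) = real n * (1 - lam) * no_token_prob"
    by (simp add: no_token_prob_def)
  moreover have "expect (\<lambda>x. of_bool (tokens x = 0) * idle x + ?def x)
      = expect (\<lambda>x. of_bool (tokens x = 0) * idle x) + real n * mean_excess_idle"
    using int int_def by (simp add: mean_idle_deficit)
  ultimately have "real n * ((1 - lam) * no_token_prob) \<le> real n * (2 * lam / \<mu> + mean_excess_idle)"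
    using expect_tokenless_idle_le by (simp only: distrib_left mult.assoc)
  then show ?thesis using n_pos by simp
qed

lemma mean_excess_idle_le: "mean_excess_idle \<le> sqrt (lam * mean_tokenless_excess_idle + 1 / real n)"
  unfolding mean_excess_idle_def mean_tokenless_excess_idle_def by (rule expect_excess_le)

end

section \<open>From the token-free probability to the delay\<close>

lemma suminf_queue_fraction:
  "(\<Sum>i. ennreal (queue_fraction n (Suc i) q)) = ennreal ((\<Sum>j<n. real (q j)) / real n)"
proof -
  define N where "N = (\<Sum>j<n. q j)"
  have qN: "q j \<le> N" if "j < n" for j
    unfolding N_def using that by (intro member_le_sum) auto
  have qf: "queue_fraction n i q = (\<Sum>j<n. of_bool (i \<le> q j)) / real n" for i
    by (simp add: queue_fraction_def of_bool_def sum.If_cases Int_def flip: lessThan_def)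
  have "(\<Sum>i. ennreal (queue_fraction n (Suc i) q)) = (\<Sum>i<N. ennreal (queue_fraction n (Suc i) q))"
  proof (rule suminf_finite)
    fix i assume "i \<notin> {..<N}"
    then have "\<not> Suc i \<le> q j" if "j < n" for j using qN[OF that] by simp
    then show "ennreal (queue_fraction n (Suc i) q) = 0" by (simp add: qf)
  qed simp
  also have "\<dots> = ennreal (\<Sum>i<N. queue_fraction n (Suc i) q)"
    by (rule sum_ennreal) (simp add: queue_fraction_def)
  also have "(\<Sum>i<N. queue_fraction n (Suc i) q) = (\<Sum>j<n. \<Sum>i<N. of_bool (Suc i \<le> q j)) / real n"
    unfolding qf sum_divide_distrib[symmetric] by (subst sum.swap) rule
  also have "(\<Sum>j<n. \<Sum>i<N. of_bool (Suc i \<le> q j)) = (\<Sum>j<n. real (q j))"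
  proof (rule sum.cong[OF refl])
    fix j assume "j \<in> {..<n}"
    then have "{..<N} \<inter> {i. Suc i \<le> q j} = {..<q j}" using qN[of j] by auto
    then show "(\<Sum>i<N. of_bool (Suc i \<le> q j)) = real (q j)"
      by (simp add: of_bool_def sum.If_cases Suc_le_eq)
  qed
  finally show ?thesis .
qed

context stationary_rcpb begin

lemma queueing_delay_bounds:
  "0 \<le> queueing_delay n lam \<pi>"
  "L > 0 \<Longrightarrow> queueing_delay n lam \<pi> \<le> ereal (second_moment_bound / L + L * no_token_prob)"
proof -
  define N where "N = (\<integral>\<^sup>+(q, m). (\<Sum>i. ennreal (queue_fraction n (Suc i) q)) \<partial>measure_pmf \<pi>)"
  have N: "N = (\<integral>\<^sup>+x. ennreal ((\<Sum>j<n. real (fst x j)) / real n) \<partial>measure_pmf \<pi>)"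
    unfolding N_def by (intro nn_integral_cong) (simp add: suminf_queue_fraction split: prod.split)
  have upper: "N \<le> ennreal (lam * (1 + second_moment_bound / L + L * no_token_prob))"
    if L: "L > 0" for L
  proof -
    let ?Y = "\<lambda>K x. ennreal (jobs_upto 1 (Suc K) x / real n)"
    have "ennreal ((\<Sum>j<n. real (fst x j)) / real n) = (SUP K. ?Y K x)" for x
    proof (rule antisym)
      define M where "M = (\<Sum>j<n. fst x j)"
      have "jobs_upto 1 (Suc M) x = (\<Sum>j<n. real (fst x j))"
        unfolding jobs_upto_def
      proof (rule sum.cong[OF refl])
        fix j assume "j \<in> {..<n}"
        then have "fst x j \<le> M" unfolding M_def by (intro member_le_sum) auto
        then show "(if fst x j \<le> Suc M then real (fst x j) ^ 1 else 0) = real (fst x j)" by simp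
      qed
      then show "ennreal ((\<Sum>j<n. real (fst x j)) / real n) \<le> (SUP K. ?Y K x)"
        by (metis SUP_upper UNIV_I)
      have "jobs_upto 1 K x \<le> (\<Sum>j<n. real (fst x j))" for K
        unfolding jobs_upto_def by (intro sum_mono) auto
      then show "(SUP K. ?Y K x) \<le> ennreal ((\<Sum>j<n. real (fst x j)) / real n)"
        by (intro SUP_least ennreal_leI divide_right_mono) auto
    qed
    then have "N = (\<integral>\<^sup>+x. (SUP K. ?Y K x) \<partial>measure_pmf \<pi>)" by (simp add: N)
    also have "\<dots> = (SUP K. \<integral>\<^sup>+x. ?Y K x \<partial>measure_pmf \<pi>)"
    proof (rule nn_integral_monotone_convergence_SUP)
      show "incseq ?Y"
        unfolding jobs_upto_def
        by (intro monoI le_funI ennreal_leI divide_right_mono sum_mono) auto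
    qed simp
    also have "\<dots> \<le> ennreal (lam * (1 + second_moment_bound / L + L * no_token_prob))"
    proof (rule SUP_least)
      fix K
      have "(\<integral>\<^sup>+x. ?Y K x \<partial>measure_pmf \<pi>) = ennreal (expect (jobs_upto 1 (Suc K)) / real n)"
        using integrable_jobs_upto[of 1 "Suc K"]
        by (subst nn_integral_eq_integral) (auto simp: jobs_upto_nonneg)
      also have "\<dots> \<le> ennreal (lam * (1 + second_moment_bound / L + L * no_token_prob))"
        using expect_jobs_le_no_token_prob[of "Suc K" L] L n_pos
        by (intro ennreal_leI) (simp add: divide_le_eq mult.commute)
      finally show "(\<integral>\<^sup>+x. ?Y K x \<partial>measure_pmf \<pi>)
          \<le> ennreal (lam * (1 + second_moment_bound / L + L * no_token_prob))" .
    qed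
    finally show ?thesis .
  qed
  have "ennreal lam \<le> N"
  proof -
    \<comment> \<open>Busy servers hold at least one job each.\<close>
    have "lam = expect (\<lambda>x. (real n - idle x) / real n)"
      using integrable_idle expect_idle n_pos by (simp add: field_simps)
    then have "ennreal lam = ennreal (expect (\<lambda>x. (real n - idle x) / real n))" by simp
    also have "\<dots> = (\<integral>\<^sup>+x. ennreal ((real n - idle x) / real n) \<partial>measure_pmf \<pi>)"
      using integrable_idle idle_bounds by (intro nn_integral_eq_integral[symmetric]) auto
    also have "\<dots> \<le> N"
      unfolding N busy_eq
      by (intro nn_integral_mono ennreal_leI divide_right_mono sum_mono) auto
    finally show ?thesis .
  qed
  moreover have "N < top" using upper[of 1] by (simp add: le_less_trans)
  ultimately obtain r where r: "N = ennreal r" "lam \<le> r"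
    using lam by (cases N) auto
  have delay: "queueing_delay n lam \<pi> = ereal (r / lam - 1)"
    using r lam unfolding queueing_delay_def N_def[symmetric] by (simp add: one_ereal_def)
  show "0 \<le> queueing_delay n lam \<pi>"
    using r lam by (simp add: delay)
  assume L: "L > 0"
  have "0 \<le> second_moment_bound" using lam by (simp add: second_moment_bound_def)
  then have "0 \<le> lam * (1 + second_moment_bound / L + L * no_token_prob)"
    using L lam no_token_prob_bounds by simp
  then have "r \<le> lam * (1 + second_moment_bound / L + L * no_token_prob)"
    using upper[OF L] r by (simp add: ennreal_le_iff)
  then show "queueing_delay n lam \<pi> \<le> ereal (second_moment_bound / L + L * no_token_prob)"
    using lam by (simp add: delay field_simps)
qed

text \<open>Optimises \<open>L\<close>. The summand \<open>1/n\<close> keeps the square root positive, so that \<open>L\<close> is defined even if the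
  token-free probability is \<open>0\<close>.\<close>

lemma queueing_delay_le_sqrt:
  "queueing_delay n lam \<pi> \<le> ereal ((second_moment_bound + 1) * sqrt (no_token_prob + 1 / real n))"
proof -
  define s where "s = sqrt (no_token_prob + 1 / real n)"
  have s: "0 < s" "no_token_prob \<le> s * s"
    using n_pos no_token_prob_bounds by (auto simp: s_def add_nonneg_pos)
  have "queueing_delay n lam \<pi> \<le> ereal (second_moment_bound / (1 / s) + 1 / s * no_token_prob)"
    by (rule queueing_delay_bounds) (use s in simp)
  also have "\<dots> \<le> ereal ((second_moment_bound + 1) * s)"
    using s by (simp add: field_simps)
  finally show ?thesis by (simp add: s_def)
qed

end

section \<open>The two regimes\<close>

text \<open>The error \<open>b K\<close> vanishes only for fixed \<open>K\<close>, so the limit in \<open>n\<close> is taken before the one in \<open>K\<close>.\<close>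

lemma tendsto_0_by_cuts:
  fixes a :: "nat \<Rightarrow> real"
  assumes nonneg: "eventually (\<lambda>n. 0 \<le> a n) sequentially"
    and le: "\<And>K. K \<ge> 1 \<Longrightarrow> eventually (\<lambda>n. a n \<le> 1 / real K + b K n) sequentially"
    and b: "\<And>K. b K \<longlonglongrightarrow> 0"
  shows "a \<longlonglongrightarrow> 0"
proof (rule tendstoI)
  fix e :: real assume e: "0 < e"
  obtain K where K: "K \<ge> 1" "1 / real K < e / 2"
    using e by (metis One_nat_def Suc_leI half_gt_zero inverse_eq_divide ex_inverse_of_nat_less)
  have "eventually (\<lambda>n. b K n < e / 2) sequentially"
    using e by (intro order_tendstoD(2)[OF b]) simp
  with nonneg le[OF K(1)] show "eventually (\<lambda>n. dist (a n) 0 < e) sequentially"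
    by eventually_elim (use K in \<open>auto simp: dist_real_def\<close>)
qed

theorem corollary3p5:
  fixes lam :: real and c :: "nat \<Rightarrow> nat" and \<mu> :: "nat \<Rightarrow> real"
    and P :: "nat \<Rightarrow> real \<Rightarrow> rcpb_state \<Rightarrow> rcpb_state pmf"
    and \<pi> :: "nat \<Rightarrow> rcpb_state pmf"
  assumes "0 < lam" and "lam < 1"
    and regime: "(\<exists>\<mu>0 \<ge> lam / (1 - lam). high_memory c \<mu> \<mu>0) \<or> high_message c \<mu>"
    and chain: "\<And>n. c n \<in> {1..n} \<Longrightarrow>
      ctmc (rcpb_states n (c n)) (rcpb_rate n lam (c n) (\<mu> n)) (P n)"
    and stationary: "\<And>n. c n \<in> {1..n} \<Longrightarrow>
      stationary_distribution (rcpb_states n (c n)) (P n) (\<pi> n)"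
  shows "asymptotic_delay lam \<pi> = 0"
proof -
  define A where "A n = stationary_rcpb.mean_tokenless_excess_idle n lam (\<pi> n)" for n
  define W where "W n = stationary_rcpb.mean_excess_idle n lam (\<pi> n)" for n
  define p where "p n = stationary_rcpb.no_token_prob (\<pi> n)" for n
  note defs = A_def W_def p_def
  have chains: "eventually (\<lambda>n. stationary_rcpb n (c n) lam (\<mu> n) (P n) (\<pi> n)) sequentially"
  proof -
    have "eventually (\<lambda>n. c n \<in> {1..n} \<and> 0 < \<mu> n) sequentially"
      using regime
    proof
      assume "\<exists>\<mu>0 \<ge> lam / (1 - lam). high_memory c \<mu> \<mu>0"
      then show ?thesis
        unfolding high_memory_def by (auto simp: eventually_sequentially intro!: exI[of _ 1])
    next
      assume "high_message c \<mu>"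
      then show ?thesis
        unfolding high_message_def by (auto simp: eventually_sequentially)
    qed
    then show ?thesis
      by eventually_elim (use assms chain stationary in \<open>auto simp: stationary_rcpb_def\<close>)
  qed
  have nonneg: "eventually (\<lambda>n. 0 \<le> A n \<and> 0 \<le> W n \<and> 0 \<le> p n) sequentially"
    using chains
    by eventually_elim
      (simp add: defs stationary_rcpb.mean_excess_idle_nonneg stationary_rcpb.no_token_prob_bounds)
  have W_if: "W \<longlonglongrightarrow> 0" if A: "A \<longlonglongrightarrow> 0"
  proof (rule tendsto_sandwich[OF _ _ tendsto_const])
    show "eventually (\<lambda>n. 0 \<le> W n) sequentially" using nonneg by eventually_elim simp
    show "eventually (\<lambda>n. W n \<le> sqrt (lam * A n + 1 / real n)) sequentially"
      using chains by eventually_elim (simp add: defs stationary_rcpb.mean_excess_idle_le)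
    have "(\<lambda>n. sqrt (lam * A n + 1 / real n)) \<longlonglongrightarrow> sqrt (lam * 0 + 0)"
      by (intro tendsto_intros A lim_1_over_n)
    then show "(\<lambda>n. sqrt (lam * A n + 1 / real n)) \<longlonglongrightarrow> 0" by simp
  qed
  have p: "p \<longlonglongrightarrow> 0"
    using regime
  proof
    assume "\<exists>\<mu>0 \<ge> lam / (1 - lam). high_memory c \<mu> \<mu>0"
    then obtain \<mu>0 where mu0: "lam / (1 - lam) \<le> \<mu>0" and hm: "high_memory c \<mu> \<mu>0" by auto
    have crit: "lam \<le> \<mu>0 * (1 - lam)" using mu0 assms(2) by (simp add: field_simps)
    have mu: "eventually (\<lambda>n. \<mu> n = \<mu>0) sequentially"
      using hm unfolding high_memory_def by (auto simp: eventually_sequentially)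
    have cK: "eventually (\<lambda>n. K \<le> c n) sequentially" for K
      using hm unfolding high_memory_def filterlim_at_top by blast
    define b where "b d K n = real K * ((lam + \<mu>0 * real K) / lam * (1 / real n) + \<mu>0 / lam * d n)"
      for d :: "nat \<Rightarrow> real" and K n :: nat
    have b: "b d K \<longlonglongrightarrow> 0" if "d \<longlonglongrightarrow> 0" for d K
      unfolding b_def by (intro tendsto_mult_right_zero tendsto_add_zero lim_1_over_n that)
    have "A \<longlonglongrightarrow> 0"
    proof (rule tendsto_0_by_cuts)
      show "eventually (\<lambda>n. 0 \<le> A n) sequentially" using nonneg by eventually_elim simp
      show "b (\<lambda>_. 0) K \<longlonglongrightarrow> 0" for K by (rule b) simp
      show "eventually (\<lambda>n. A n \<le> 1 / real K + b (\<lambda>_. 0) K n) sequentially" if K: "K \<ge> 1" for K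
        using chains mu cK[of K]
      proof eventually_elim
        case (elim n)
        then interpret stationary_rcpb n "c n" lam \<mu>0 "P n" "\<pi> n" by simp
        show ?case
          unfolding defs b_def using mean_tokenless_excess_idle_le_many_tokens K elim crit by simp
      qed
    qed
    then have W: "W \<longlonglongrightarrow> 0" by (rule W_if)
    show "p \<longlonglongrightarrow> 0"
    proof (rule tendsto_0_by_cuts)
      show "eventually (\<lambda>n. 0 \<le> p n) sequentially" using nonneg by eventually_elim simp
      show "b W K \<longlonglongrightarrow> 0" for K by (rule b) (rule W)
      show "eventually (\<lambda>n. p n \<le> 1 / real K + b W K n) sequentially" if K: "K \<ge> 1" for K
        using chains mu cK[of K]
      proof eventually_elim
        case (elim n)
        then interpret stationary_rcpb n "c n" lam \<mu>0 "P n" "\<pi> n" by simp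
        show ?case
          unfolding defs b_def using no_token_prob_le_many_tokens K elim crit by simp
      qed
    qed
  next
    assume "high_message c \<mu>"
    then have "filterlim \<mu> at_top sequentially" by (auto simp: high_message_def)
    then have mu: "(\<lambda>n. 2 * lam / \<mu> n) \<longlonglongrightarrow> 0"
      by (intro tendsto_divide_0[OF tendsto_const] filterlim_at_top_imp_at_infinity)
    have "A \<longlonglongrightarrow> 0"
    proof (rule tendsto_sandwich[OF _ _ tendsto_const mu])
      show "eventually (\<lambda>n. 0 \<le> A n) sequentially" using nonneg by eventually_elim simp
      show "eventually (\<lambda>n. A n \<le> 2 * lam / \<mu> n) sequentially"
        using chains
        by eventually_elim (simp add: defs stationary_rcpb.mean_tokenless_excess_idle_le_fast_messages)
    qed
    then have W: "W \<longlonglongrightarrow> 0" by (rule W_if)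
    show "p \<longlonglongrightarrow> 0"
    proof (rule tendsto_sandwich[OF _ _ tendsto_const])
      show "eventually (\<lambda>n. 0 \<le> p n) sequentially" using nonneg by eventually_elim simp
      show "eventually (\<lambda>n. p n \<le> (2 * lam / \<mu> n + W n) / (1 - lam)) sequentially"
        using chains
      proof eventually_elim
        case (elim n)
        then interpret stationary_rcpb n "c n" lam "\<mu> n" "P n" "\<pi> n" .
        show ?case
          unfolding defs using no_token_prob_le_fast_messages lam
          by (simp add: le_divide_eq mult.commute)
      qed
      show "(\<lambda>n. (2 * lam / \<mu> n + W n) / (1 - lam)) \<longlonglongrightarrow> 0"
        using tendsto_divide[OF tendsto_add[OF mu W] tendsto_const[of "1 - lam"]] assms(2) by simp
    qed
  qed
  define C where "C = stationary_rcpb.second_moment_bound lam"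
  have "(\<lambda>n. (C + 1) * sqrt (p n + 1 / real n)) \<longlonglongrightarrow> (C + 1) * sqrt (0 + 0)"
    by (intro tendsto_intros p lim_1_over_n)
  then have "(\<lambda>n. ereal ((C + 1) * sqrt (p n + 1 / real n))) \<longlonglongrightarrow> 0"
    by (simp add: zero_ereal_def)
  then have "(\<lambda>n. queueing_delay n lam (\<pi> n)) \<longlonglongrightarrow> 0"
  proof (rule tendsto_sandwich[OF _ _ tendsto_const, rotated -1])
    show "eventually (\<lambda>n. 0 \<le> queueing_delay n lam (\<pi> n)) sequentially"
      using chains by eventually_elim (rule stationary_rcpb.queueing_delay_bounds)
    show "eventually (\<lambda>n. queueing_delay n lam (\<pi> n) \<le> ereal ((C + 1) * sqrt (p n + 1 / real n))) sequentially"
      using chains by eventually_elim (simp add: C_def p_def stationary_rcpb.queueing_delay_le_sqrt)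
  qed
  then show ?thesis
    unfolding asymptotic_delay_def by (intro lim_imp_Limsup) auto
qed

end
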